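(* Let $q\ge1$ and $x_0\in\mathbb R^d$. For every $(\beta,p,\mathcal P)\in(0,+\infty)^d\times[1,\infty]^d\times\mathfrak P$ and every $L\in(0,\infty)^d$ there exists $c>0$ such that $$\liminf_{n\to+\infty}\Big\{\rho_n^{-1}(\beta,p,\mathcal P)\inf_{\widetilde f_n}\mathcal R_n^{(q)}\big[\widetilde f_n,N_{p,d}(\beta,L,\mathcal P)\big]\Big\}\ge c,$$ where the infimum is taken over all possible estimators.
   Context: **Setting.** $X_1,X_2,\dots$ are i.i.d. $\mathbb R^d$-valued random vectors with density $f$ with respect to Lebesgue measure; $X^{(n)}=(X_1,\dots,X_n)$, $\mathbb E_f^{(n)}$ is the expectation under the law of $X^{(n)}$. An estimator is any $X^{(n)}$-measurable map. For a set $\Sigma$ of densities, $\mathcal R_n^{(q)}[\widehat f,\Sigma]=\sup_{f\in\Sigma}(\mathbb E_f^{(n)}|\widehat f(x_0)-f(x_0)|^q)^{1/q}$. **Partitions.** $\mathfrak P$ is the set of all partitions of $\{1,\dots,d\}$; for $I\subseteq\{1,\dots,d\}$, $x_I=(x_i)_{i\in I}$ (similarly $\beta_I,p_I,L_I$) and $f_I(x_I)=\int f(x)\,dx_{\overline I}$, $\overline I=\{1,\dots,d\}\setminus I$, is the marginal density. **Nikolskii class.** For $p\in[1,\infty]^s$, $\beta,L\in(0,\infty)^s$, $\mathbb N_{p,s}(\beta,L)$ is the set of functions $f:\mathbb R^s\to\mathbb R$ such that for all $i=1,\dots,s$: (i) $\|D_i^kf\|_{p_i}\le L_i$ for all $k=0,\dots,\lfloor\beta_i\rfloor$;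 (ii) $\|D_i^{\lfloor\beta_i\rfloor}f(\cdot+te_i)-D_i^{\lfloor\beta_i\rfloor}f(\cdot)\|_{p_i}\le L_i|t|^{\beta_i-\lfloor\beta_i\rfloor}$ for all $t\in\mathbb R$. Here $D_i^kf$ is the $k$-th order partial derivative in the $i$-th variable, $(e_i)$ the canonical basis, and $\lfloor\beta_i\rfloor$ the largest integer strictly less than $\beta_i$. **Class with independence structure.** $N_{p,d}(\beta,L,\mathcal P)$ is the set of probability densities $f:\mathbb R^d\to\mathbb R_+$ with $f(x)=\prod_{I\in\mathcal P}f_I(x_I)$ for all $x\in\mathbb R^d$ and $f_I\in\mathbb N_{p_I,|I|}(\beta_I,L_I)$ for all $I\in\mathcal P$. **Rates.** $\gamma_I(\beta,p)=\dfrac{1-\sum_{i\in I}\frac1{\beta_ip_i}}{\sum_{i\in I}\frac1{\beta_i}}$, $r=r(\beta,p,\mathcal P)=\inf_{I\in\mathcal P}\gamma_I(\beta,p)$, $\varphi_n(\beta,p,\mathcal P)=(1/n)^{r/(2r+1)}$, and $\rho_n(\beta,p,\mathcal P)=\mathbf 1_{\{r\le0\}}+\varphi_n(\beta,p,\mathcal P)\mathbf 1_{\{r>0\}}$.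
   Formalization: The class N_{p,d}(β,L,P) is additionally assumed nonempty: if p_i = 1 and L_i < 1 for some i, condition (i) with k = 0 contradicts ‖f_I‖_1 = 1, so the class is empty and the claim fails; in all other cases it is nonempty. *)

theory Defs
  imports "HOL-Probability.Probability"
begin

text \<open>
  For a finite index set \<open>I\<close>, the space \<open>\<real>\<^sup>I\<close> consists of the functions in
  \<^term>\<open>I \<rightarrow>\<^sub>E (UNIV :: real set)\<close> and carries the Borel \<open>\<sigma>\<close>-algebra and Lebesgue measure
  below.  Indexing by \<open>I\<close> itself instead of by \<open>{1..card I}\<close> makes the subvector \<open>x\<^sub>I\<close> equal
  to \<^term>\<open>restrict x I\<close>, and \<open>\<beta>\<^sub>I\<close>, \<open>p\<^sub>I\<close>, \<open>L\<^sub>I\<close> are the values of \<open>\<beta>\<close>, \<open>p\<close>, \<open>L\<close> on \<open>I\<close>.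
\<close>
abbreviation leb :: "nat set \<Rightarrow> (nat \<Rightarrow> real) measure" where
  "leb I \<equiv> PiM I (\<lambda>_. lborel)"

definition Lp_norm :: "ennreal \<Rightarrow> 'a measure \<Rightarrow> ('a \<Rightarrow> real) \<Rightarrow> ennreal" where
  "Lp_norm p M g =
    (if p = \<infinity> then esssup M (\<lambda>x. ennreal \<bar>g x\<bar>)
     else let J = (\<integral>\<^sup>+ x. ennreal (\<bar>g x\<bar> powr enn2real p) \<partial>M)
          in if J = \<infinity> then \<infinity> else ennreal (enn2real J powr (1 / enn2real p)))"

text \<open>The largest integer strictly less than \<open>b\<close>, for \<open>b > 0\<close>.\<close>
definition strict_floor :: "real \<Rightarrow> nat" where
  "strict_floor b = nat (\<lceil>b\<rceil> - 1)"

lemma strict_floor_greatest: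
  assumes "0 < b"
  shows "real (strict_floor b) < b"
    and "real_of_int k < b \<Longrightarrow> k \<le> int (strict_floor b)"
proof -
  have "1 \<le> \<lceil>b\<rceil>" using assms by linarith
  hence *: "int (strict_floor b) = \<lceil>b\<rceil> - 1" by (simp add: strict_floor_def)
  hence "real (strict_floor b) = real_of_int (\<lceil>b\<rceil> - 1)" by (metis of_int_of_nat_eq)
  thus "real (strict_floor b) < b" by linarith
  show "k \<le> int (strict_floor b)" if "real_of_int k < b"
    using that * by linarith
qed

definition partial_deriv :: "nat \<Rightarrow> nat \<Rightarrow> ((nat \<Rightarrow> real) \<Rightarrow> real) \<Rightarrow> (nat \<Rightarrow> real) \<Rightarrow> real" where
  "partial_deriv i k f x = (deriv ^^ k) (\<lambda>t. f (x(i := t))) (x i)"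

text \<open>
  \<^term>\<open>deriv\<close> is total, so the existence of the partial derivatives up to order \<open>m\<close> in the
  \<open>i\<close>-th variable, at every point of \<open>\<real>\<^sup>I\<close>, has to be required separately.
\<close>
definition partial_derivs_exist ::
  "nat set \<Rightarrow> nat \<Rightarrow> nat \<Rightarrow> ((nat \<Rightarrow> real) \<Rightarrow> real) \<Rightarrow> bool" where
  "partial_derivs_exist I i m f \<longleftrightarrow>
    (\<forall>x \<in> space (leb I). \<forall>k<m. \<forall>s.
       (deriv ^^ k) (\<lambda>t. f (x(i := t))) differentiable (at s))"

definition nikolskii ::
  "nat set \<Rightarrow> (nat \<Rightarrow> ennreal) \<Rightarrow> (nat \<Rightarrow> real) \<Rightarrow> (nat \<Rightarrow> real) \<Rightarrow> ((nat \<Rightarrow> real) \<Rightarrow> real) set" where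
  "nikolskii I p \<beta> L =
    {f \<in> borel_measurable (leb I). \<forall>i\<in>I.
       partial_derivs_exist I i (strict_floor (\<beta> i)) f \<and>
       (\<forall>k \<le> strict_floor (\<beta> i).
          Lp_norm (p i) (leb I) (partial_deriv i k f) \<le> ennreal (L i)) \<and>
       (\<forall>t. Lp_norm (p i) (leb I)
              (\<lambda>x. partial_deriv i (strict_floor (\<beta> i)) f (x(i := x i + t))
                   - partial_deriv i (strict_floor (\<beta> i)) f x)
            \<le> ennreal (L i * \<bar>t\<bar> powr (\<beta> i - real (strict_floor (\<beta> i)))))}"

definition is_density :: "nat set \<Rightarrow> ((nat \<Rightarrow> real) \<Rightarrow> real) \<Rightarrow> bool" where
  "is_density A f \<longleftrightarrow>
    f \<in> borel_measurable (leb A) \<and> (\<forall>x \<in> space (leb A). 0 \<le> f x) \<and>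
    (\<integral>\<^sup>+ x. ennreal (f x) \<partial>leb A) = 1"

definition marginal ::
  "nat set \<Rightarrow> nat set \<Rightarrow> ((nat \<Rightarrow> real) \<Rightarrow> real) \<Rightarrow> (nat \<Rightarrow> real) \<Rightarrow> real" where
  "marginal A I f y = (\<integral>z. f (merge I (A - I) (y, z)) \<partial>leb (A - I))"

text \<open>
  The integral defining \<^term>\<open>marginal A I f y\<close> is \<open>0\<close> where it diverges.  Members of the
  following class have no such points: there the product formula would give \<open>f = 0\<close> on the
  whole fibre over \<open>y\<close>.
\<close>
definition indep_class ::
  "nat \<Rightarrow> (nat \<Rightarrow> ennreal) \<Rightarrow> (nat \<Rightarrow> real) \<Rightarrow> (nat \<Rightarrow> real) \<Rightarrow> nat set set
    \<Rightarrow> ((nat \<Rightarrow> real) \<Rightarrow> real) set" where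
  "indep_class d p \<beta> L P =
    {f. is_density {1..d} f \<and>
        (\<forall>x \<in> space (leb {1..d}). f x = (\<Prod>I\<in>P. marginal {1..d} I f (restrict x I))) \<and>
        (\<forall>I\<in>P. marginal {1..d} I f \<in> nikolskii I p \<beta> L)}"

definition sample_law ::
  "nat \<Rightarrow> nat \<Rightarrow> ((nat \<Rightarrow> real) \<Rightarrow> real) \<Rightarrow> (nat \<Rightarrow> nat \<Rightarrow> real) measure" where
  "sample_law d n f = PiM {1..n} (\<lambda>_. density (leb {1..d}) (\<lambda>x. ennreal (f x)))"

text \<open>Estimators of the function \<open>f\<close>: every point evaluation is a measurable function of the sample.\<close>
definition estimators ::
  "nat \<Rightarrow> nat \<Rightarrow> ((nat \<Rightarrow> nat \<Rightarrow> real) \<Rightarrow> (nat \<Rightarrow> real) \<Rightarrow> real) set" where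
  "estimators d n =
    {T. \<forall>x \<in> space (leb {1..d}). (\<lambda>\<omega>. T \<omega> x) \<in> borel_measurable (PiM {1..n} (\<lambda>_. leb {1..d}))}"

definition risk ::
  "real \<Rightarrow> nat \<Rightarrow> nat \<Rightarrow> (nat \<Rightarrow> real)
    \<Rightarrow> ((nat \<Rightarrow> nat \<Rightarrow> real) \<Rightarrow> (nat \<Rightarrow> real) \<Rightarrow> real)
    \<Rightarrow> ((nat \<Rightarrow> real) \<Rightarrow> real) set \<Rightarrow> ennreal" where
  "risk q d n x0 T \<Sigma> =
    (SUP f\<in>\<Sigma>. Lp_norm (ennreal q) (sample_law d n f) (\<lambda>\<omega>. T \<omega> x0 - f x0))"

text \<open>For \<open>p i = \<infinity>\<close> the summand \<open>1 / (\<beta> i p i)\<close> is \<open>0\<close>.\<close>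
definition gamma_idx :: "nat set \<Rightarrow> (nat \<Rightarrow> real) \<Rightarrow> (nat \<Rightarrow> ennreal) \<Rightarrow> real" where
  "gamma_idx I \<beta> p = (1 - (\<Sum>i\<in>I. enn2real (1 / p i) / \<beta> i)) / (\<Sum>i\<in>I. 1 / \<beta> i)"

definition rate_idx :: "(nat \<Rightarrow> real) \<Rightarrow> (nat \<Rightarrow> ennreal) \<Rightarrow> nat set set \<Rightarrow> real" where
  "rate_idx \<beta> p P = (INF I\<in>P. gamma_idx I \<beta> p)"

definition phi_rate :: "nat \<Rightarrow> (nat \<Rightarrow> real) \<Rightarrow> (nat \<Rightarrow> ennreal) \<Rightarrow> nat set set \<Rightarrow> real" where
  "phi_rate n \<beta> p P = (1 / real n) powr (rate_idx \<beta> p P / (2 * rate_idx \<beta> p P + 1))"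

definition rho_rate :: "nat \<Rightarrow> (nat \<Rightarrow> real) \<Rightarrow> (nat \<Rightarrow> ennreal) \<Rightarrow> nat set set \<Rightarrow> real" where
  "rho_rate n \<beta> p P =
    of_bool (rate_idx \<beta> p P \<le> 0) + phi_rate n \<beta> p P * of_bool (rate_idx \<beta> p P > 0)"

end

theory Submission
  imports Defs "HOL-Computational_Algebra.Polynomial"
begin

text \<open>
  Le Cam's two-point method.  The null density is a product of wide Gaussian densities centred at
  \<open>x\<^sub>0\<close>; nonemptiness of the class is only needed to know \<open>L\<^sub>i \<ge> 1\<close> whenever \<open>p\<^sub>i = 1\<close>, because all
  other Nikolskii norms tend to \<open>0\<close> as the Gaussians widen.  The alternative adds, in the block \<open>I\<close>
  that attains the infimum \<open>r\<close>, the spike \<open>A \<Prod>\<^sub>i g ((x\<^sub>i - x\<^sub>0\<^sub>i) / h\<^sub>i)\<close> with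
  \<open>g y = (1 - y\<^sup>2) exp (- y\<^sup>2 / 2)\<close> up to a constant.  Since \<open>g\<close> has integral \<open>0\<close>, all other marginals and
  the total mass are unchanged.  With \<open>A = c n\<^sup>-\<^sup>b\<close>, where \<open>b = r / (2 r + 1)\<close> if \<open>r > 0\<close> and \<open>b = 0\<close> otherwise, and suitable powers
  \<open>h\<^sub>i\<close> of \<open>n\<close> the alternative stays in the class, while \<open>A\<^sup>2 \<Prod>\<^sub>i h\<^sub>i \<le> 1 / n\<close> keeps the \<open>\<chi>\<^sup>2\<close>
  divergence of the two sample laws bounded.
\<close>

section \<open>Polynomials times the Gaussian density\<close>

text \<open>Write V for the product of the bandwidths. A spike of height A has norms of order
  \<open>A * h_i^(-\<beta>_i) * V^(1/p_i)\<close>, which must stay bounded, while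
  indistinguishability from n observations asks for \<open>A^2 * V\<close> of order at most 1/n.
  With A and all bandwidths taken as powers of n these become linear inequalities between the
  exponents, and r is the number that decides how they are solved in
  \<open>bandwidth_exponents\<close>. Gaussian profiles replace compactly supported bumps for two
  reasons. The null has to be positive everywhere and to dominate the spike, so that the likelihood
  ratio is defined and the alternative is nonnegative. Moreover all iterated derivatives are again
  polynomials times the Gaussian, so one pointwise envelope yields every norm at every scale. The
  spike is multiplied by the null factors of the remaining blocks, so the alternative is an exact
  product and not merely close to one.\<close>

definition gauss_poly :: "real poly \<Rightarrow> real \<Rightarrow> real" where
  "gauss_poly P x = poly P x * std_normal_density x"

text \<open>Since the normal density \<phi> satisfies \<phi>'(x) = - x \<phi>(x), differentiation
  acts on the polynomial factor alone.\<close>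

definition gauss_poly_deriv :: "real poly \<Rightarrow> real poly" where
  "gauss_poly_deriv P = pderiv P - [:0, 1:] * P"

text \<open>The rate 1/8 leaves room for two losses: the polynomial factor lowers 1/2 to 1/4, and
  evaluating at a point at distance at most 1 lowers 1/4 to 1/8.\<close>

definition envelope :: "real \<Rightarrow> real" where
  "envelope x = exp (- (x\<^sup>2) / 8)"

lemma envelope_pos: "0 < envelope x"
  by (simp add: envelope_def)

lemma envelope_measurable [measurable]: "envelope \<in> borel_measurable borel"
  unfolding envelope_def by measurable

lemma gauss_poly_measurable [measurable]: "gauss_poly P \<in> borel_measurable borel"
proof -
  have "continuous_on UNIV (poly P)" by (intro continuous_on_poly continuous_on_id)
  hence [measurable]: "poly P \<in> borel_measurable borel" by (rule borel_measurable_continuous_onI)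
  show ?thesis unfolding gauss_poly_def by measurable
qed

lemma DERIV_gauss_poly:
  "(gauss_poly P has_real_derivative gauss_poly (gauss_poly_deriv P) x) (at x)"
proof -
  have "(std_normal_density has_real_derivative - x * std_normal_density x) (at x)"
    unfolding std_normal_density_def
    by (rule DERIV_cong, (rule derivative_eq_intros refl | simp)+)
  from DERIV_mult[OF poly_DERIV[of P x] this] show ?thesis
    unfolding gauss_poly_def[abs_def] gauss_poly_deriv_def by (simp add: algebra_simps)
qed

text \<open>A factor \<open>x\<close> costs an arbitrarily small share of the exponent. The
  induction therefore runs over all \<open>c\<close> at once and spends one half of \<open>c\<close>
  on the factor, the other half on the remaining polynomial.\<close>

lemma poly_le_exp:
  fixes P :: "real poly" and c :: real
  assumes "0 < c"
  shows "\<exists>C. \<forall>x. \<bar>poly P x\<bar> \<le> C * exp (c * \<bar>x\<bar>)"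
  using assms
proof (induction P arbitrary: c)
  case 0
  show ?case by (intro exI[of _ 0]) simp
next
  case (pCons a P)
  obtain C where C: "\<bar>poly P x\<bar> \<le> C * exp (c / 2 * \<bar>x\<bar>)" for x
    using pCons.IH[of "c / 2"] pCons.prems by auto
  have "\<bar>poly (pCons a P) x\<bar> \<le> (\<bar>a\<bar> + C * (2 / c)) * exp (c * \<bar>x\<bar>)" for x
  proof -
    have C0: "0 \<le> C" using C[of 0] by simp
    have "\<bar>x\<bar> \<le> 2 / c * exp (c / 2 * \<bar>x\<bar>)"
      using exp_ge_add_one_self[of "c / 2 * \<bar>x\<bar>"] pCons.prems by (simp add: field_simps)
    hence "\<bar>x\<bar> * \<bar>poly P x\<bar> \<le> (2 / c * exp (c / 2 * \<bar>x\<bar>)) * (C * exp (c / 2 * \<bar>x\<bar>))"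
      using C[of x] pCons.prems by (intro mult_mono) auto
    also have "\<dots> = C * (2 / c) * exp (c * \<bar>x\<bar>)"
      by (simp add: mult_exp_exp algebra_simps flip: exp_add)
    finally have "\<bar>x\<bar> * \<bar>poly P x\<bar> \<le> C * (2 / c) * exp (c * \<bar>x\<bar>)" .
    moreover have "\<bar>a\<bar> \<le> \<bar>a\<bar> * exp (c * \<bar>x\<bar>)"
      using pCons.prems by (simp add: mult_le_cancel_left1)
    moreover have "\<bar>poly (pCons a P) x\<bar> \<le> \<bar>a\<bar> + \<bar>x\<bar> * \<bar>poly P x\<bar>"
      using abs_triangle_ineq[of a "x * poly P x"] by (simp add: abs_mult)
    ultimately show ?thesis unfolding distrib_right by linarith
  qed
  thus ?case by blast
qed

lemma gauss_poly_le_exp: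
  obtains C where "1 \<le> C" "\<And>x. \<bar>gauss_poly P x\<bar> \<le> C * exp (- (x\<^sup>2) / 4)"
proof -
  obtain C where C: "\<bar>poly P x\<bar> \<le> C * exp (1 * \<bar>x\<bar>)" for x
    using poly_le_exp[of 1 P] by auto
  have C0: "0 \<le> C" using C[of 0] by simp
  have "\<bar>gauss_poly P x\<bar> \<le> (C * exp 1 + 1) * exp (- (x\<^sup>2) / 4)" for x
  proof -
    have "\<bar>x\<bar> \<le> 1 + x\<^sup>2 / 4"
      using zero_le_power2[of "\<bar>x\<bar> / 2 - 1"] by (simp add: power2_eq_square algebra_simps)
    hence "\<bar>poly P x\<bar> \<le> C * exp (1 + x\<^sup>2 / 4)"
      using C[of x] C0 by (smt (verit) exp_le_cancel_iff mult_left_mono)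
    moreover have "std_normal_density x \<le> exp (- (x\<^sup>2) / 2)"
      using pi_ge_two by (simp add: std_normal_density_def field_simps)
    ultimately have "\<bar>gauss_poly P x\<bar> \<le> C * exp (1 + x\<^sup>2 / 4) * exp (- (x\<^sup>2) / 2)"
      unfolding gauss_poly_def abs_mult using C0 by (intro mult_mono) auto
    also have "\<dots> = C * exp 1 * exp (- (x\<^sup>2) / 4)"
      by (simp add: mult.assoc flip: exp_add)
    also have "\<dots> \<le> (C * exp 1 + 1) * exp (- (x\<^sup>2) / 4)"
      by (intro mult_right_mono) auto
    finally show ?thesis .
  qed
  thus thesis using C0 by (intro that[of "C * exp 1 + 1"]) auto
qed

lemma gauss_poly_bound:
  obtains C where "1 \<le> C" "\<And>x. \<bar>gauss_poly P x\<bar> \<le> C * envelope x"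
proof -
  obtain C where C: "1 \<le> C" "\<And>x. \<bar>gauss_poly P x\<bar> \<le> C * exp (- (x\<^sup>2) / 4)"
    by (rule gauss_poly_le_exp[of P]) blast
  have "C * exp (- (x\<^sup>2) / 4) \<le> C * envelope x" for x
    unfolding envelope_def using C(1) by (intro mult_left_mono) auto
  thus thesis using C that by (meson order_trans)
qed

text \<open>For large \<open>t\<close> the triangle inequality suffices because
  \<open>\<bar>t\<bar> powr \<alpha>\<close> is at least 1; for small \<open>t\<close> the mean
  value inequality does, because \<open>\<bar>t\<bar>\<close> is then at most
  \<open>\<bar>t\<bar> powr \<alpha>\<close>. The constant does not depend on \<alpha>, and for
  large \<open>t\<close> both end points need their own envelope.\<close>

lemma gauss_poly_modulus_bound:
  obtains C where "1 \<le> C"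
    "\<And>\<alpha> t x. 0 \<le> \<alpha> \<Longrightarrow> \<alpha> \<le> 1 \<Longrightarrow>
       \<bar>gauss_poly P (x + t) - gauss_poly P x\<bar> \<le> C * \<bar>t\<bar> powr \<alpha> * (envelope x + envelope (x + t))"
proof -
  obtain C0 where C0: "1 \<le> C0" "\<And>x. \<bar>gauss_poly P x\<bar> \<le> C0 * envelope x"
    by (rule gauss_poly_bound[of P]) blast
  obtain C1 where C1: "1 \<le> C1"
      "\<And>x. \<bar>gauss_poly (gauss_poly_deriv P) x\<bar> \<le> C1 * exp (- (x\<^sup>2) / 4)"
    by (rule gauss_poly_le_exp[of "gauss_poly_deriv P"]) blast
  define C where "C = C0 + C1 * exp (1 / 4)"
  have C: "C0 \<le> C" "C1 * exp (1 / 4) \<le> C" "1 \<le> C"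
    unfolding C_def using C0(1) C1(1) by (auto simp: add_increasing2)
  have "\<bar>gauss_poly P (x + t) - gauss_poly P x\<bar> \<le> C * \<bar>t\<bar> powr \<alpha> * (envelope x + envelope (x + t))"
    if \<alpha>: "0 \<le> \<alpha>" "\<alpha> \<le> 1" for \<alpha> t x
  proof (cases "\<bar>t\<bar> \<le> 1")
    case False
    hence "1 \<le> \<bar>t\<bar> powr \<alpha>" using \<alpha> by (simp add: ge_one_powr_ge_zero)
    have "\<bar>gauss_poly P (x + t) - gauss_poly P x\<bar> \<le> C0 * (envelope x + envelope (x + t))"
      using C0(2)[of x] C0(2)[of "x + t"] by (simp add: distrib_left)
    also have "\<dots> \<le> (C * \<bar>t\<bar> powr \<alpha>) * (envelope x + envelope (x + t))"
      using C \<open>1 \<le> \<bar>t\<bar> powr \<alpha>\<close> C0(1) envelope_pos[of x] envelope_pos[of "x + t"]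
      by (intro mult_right_mono) (auto intro: order_trans[OF _ mult_left_mono[of 1]])
    finally show ?thesis .
  next
    case True
    have d: "\<bar>gauss_poly (gauss_poly_deriv P) z\<bar> \<le> C * envelope x" if "\<bar>z - x\<bar> \<le> \<bar>t\<bar>" for z
    proof -
      have "(z - x)\<^sup>2 \<le> 1" using that True by (auto simp: abs_square_le_1)
      \<comment> \<open>This square equals
        \<open>2 * z\<^sup>2 + 2 * (z - x)\<^sup>2 - x\<^sup>2\<close>, hence
        \<open>x\<^sup>2 \<le> 2 * z\<^sup>2 + 2\<close>.\<close>
      moreover have "0 \<le> (2 * z - x)\<^sup>2" by simp
      ultimately have "- (z\<^sup>2) / 4 \<le> 1 / 4 + - (x\<^sup>2) / 8"
        by (simp add: power2_eq_square algebra_simps)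
      hence "C1 * exp (- (z\<^sup>2) / 4) \<le> C1 * exp (1 / 4 + - (x\<^sup>2) / 8)"
        using C1(1) by (intro mult_left_mono) auto
      also have "\<dots> = C1 * exp (1 / 4) * envelope x"
        by (simp add: envelope_def mult.assoc flip: exp_add)
      also have "\<dots> \<le> C * envelope x"
        using C envelope_pos[of x] by (intro mult_right_mono) auto
      finally show ?thesis using C1(2)[of z] by linarith
    qed
    have "\<bar>gauss_poly P (x + t) - gauss_poly P x\<bar> \<le> C * envelope x * \<bar>(x + t) - x\<bar>"
      unfolding real_norm_def[symmetric]
    proof (rule field_differentiable_bound[where S = "closed_segment x (x + t)"
            and f' = "gauss_poly (gauss_poly_deriv P)"])
      show "norm (gauss_poly (gauss_poly_deriv P) z) \<le> C * envelope x"
        if "z \<in> closed_segment x (x + t)" for z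
        using d[of z] segment_bound1[OF that] by simp
    qed (auto intro: has_field_derivative_at_within DERIV_gauss_poly)
    also have "\<dots> \<le> C * envelope x * \<bar>t\<bar> powr \<alpha>"
    proof -
      have "\<bar>t\<bar> \<le> \<bar>t\<bar> powr \<alpha>"
        using \<alpha> True powr_mono'[of \<alpha> 1 "\<bar>t\<bar>"] by (cases "t = 0") auto
      thus ?thesis using C envelope_pos[of x] by (intro mult_left_mono) auto
    qed
    also have "\<dots> \<le> C * \<bar>t\<bar> powr \<alpha> * (envelope x + envelope (x + t))"
      using C envelope_pos[of "x + t"] by (simp add: algebra_simps)
    finally show ?thesis .
  qed
  thus thesis using C by (intro that[of C]) auto
qed

section \<open>Integrals of the envelope and of the profiles under rescaling\<close>

definition envelope_mass :: real where
  "envelope_mass = (\<integral>x. envelope x \<partial>lborel)"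

text \<open>The envelope is the centred normal density of variance 4 without its normalising factor.
  The lower bound 1 on the mass lets the same power of the mass serve in the bounds for every
  exponent p.\<close>

lemma envelope_has_integral:
  "integrable lborel envelope" "1 \<le> envelope_mass"
proof -
  have *: "envelope = (\<lambda>x. sqrt (2 * pi * 2\<^sup>2) * normal_density 0 2 x)"
    by (auto simp: normal_density_def envelope_def fun_eq_iff real_sqrt_mult)
  show "integrable lborel envelope" unfolding * by auto
  have "envelope_mass = sqrt (2 * pi * 2\<^sup>2)"
    unfolding envelope_mass_def * by simp
  also have "1 \<le> sqrt (2 * pi * 2\<^sup>2)" using pi_ge_two by (intro real_le_rsqrt) simp
  finally show "1 \<le> envelope_mass" .
qed

lemma nn_integral_envelope: "(\<integral>\<^sup>+x. ennreal (envelope x) \<partial>lborel) = ennreal envelope_mass"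
  unfolding envelope_mass_def
  by (rule nn_integral_eq_integral[OF envelope_has_integral(1)]) (simp add: envelope_pos less_imp_le)

lemma nn_integral_rescale:
  fixes a h :: real
  assumes [measurable]: "f \<in> borel_measurable borel" and "0 < h"
  shows "(\<integral>\<^sup>+x. f ((x - a) / h) \<partial>lborel) = ennreal h * (\<integral>\<^sup>+x. f x \<partial>lborel)"
  using assms(2) by (subst nn_integral_real_affine[where c = h and t = a]) auto

lemma integral_rescale:
  fixes a h :: real and f :: "real \<Rightarrow> real"
  assumes "integrable lborel f" and "0 < h"
  shows "integrable lborel (\<lambda>x. f ((x - a) / h))"
    and "(\<integral>x. f ((x - a) / h) \<partial>lborel) = h * (\<integral>x. f x \<partial>lborel)"
proof -
  have *: "(x - a) / h = - a / h + (1 / h) * x" for x using assms(2) by (simp add: field_simps)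
  show "integrable lborel (\<lambda>x. f ((x - a) / h))"
    unfolding * using assms by (intro lborel_integrable_real_affine) auto
  show "(\<integral>x. f ((x - a) / h) \<partial>lborel) = h * (\<integral>x. f x \<partial>lborel)"
    using assms(2) by (subst lborel_integral_real_affine[where c = h and t = a]) auto
qed

lemma gauss_poly_integrable: "integrable lborel (gauss_poly P)"
proof -
  obtain C where C: "1 \<le> C" "\<And>x. \<bar>gauss_poly P x\<bar> \<le> C * envelope x"
    by (rule gauss_poly_bound[of P]) blast
  show ?thesis
    by (rule Bochner_Integration.integrable_bound[of _ "\<lambda>x. C * envelope x"])
      (use C in \<open>auto intro!: envelope_has_integral order_trans[OF C(2)]\<close>)
qed

lemma gauss_poly_1_integral: "(\<integral>x. gauss_poly 1 x \<partial>lborel) = 1"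
  by (simp add: gauss_poly_def)

text \<open>\<open>gauss_poly wave\<close> is minus the second derivative of the normal density (the
  Mexican hat): it has mean zero and yet a positive value at 0, where the two densities must
  differ.\<close>

definition wave :: "real poly" where "wave = [:1, 0, -1:]"

lemma gauss_poly_wave_integral: "(\<integral>x. gauss_poly wave x \<partial>lborel) = 0"
proof -
  have "(\<integral>x. gauss_poly wave x \<partial>lborel)
      = (\<integral>x. std_normal_density x * x ^ (2 * 0) - std_normal_density x * x ^ (2 * 1) \<partial>lborel)"
    by (simp add: gauss_poly_def wave_def algebra_simps power2_eq_square)
  also have "\<dots> = 0"
    by (subst Bochner_Integration.integral_diff)
      (auto simp only: integrable_std_normal_moment integral_std_normal_moment_even, simp)
  finally show ?thesis .
qed

section \<open>Membership in Nikolskii classes\<close>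

text \<open>A certificate for \<open>Lp_norm p M F \<le> K\<close> without roots and without a case
  for infinite integrals. For infinite p it asks for a pointwise instead of an essential
  bound.\<close>

definition Lp_bounded :: "ennreal \<Rightarrow> 'a measure \<Rightarrow> ('a \<Rightarrow> real) \<Rightarrow> real \<Rightarrow> bool" where
  "Lp_bounded p M F K \<longleftrightarrow> F \<in> borel_measurable M \<and> 0 \<le> K \<and>
    (if p = \<infinity> then \<forall>x\<in>space M. \<bar>F x\<bar> \<le> K
     else (\<integral>\<^sup>+x. ennreal (\<bar>F x\<bar> powr enn2real p) \<partial>M) \<le> ennreal (K powr enn2real p))"

lemma ennreal_exponent_cases:
  fixes p :: ennreal
  assumes "1 \<le> p"
  obtains "p = \<infinity>" "enn2real (1 / p) = 0"
  | r where "p = ennreal r" "1 \<le> r" "enn2real p = r" "enn2real (1 / p) = 1 / r" "p \<noteq> \<infinity>"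
proof (cases p)
  case (real r)
  hence r: "1 \<le> r" using assms by simp
  have "1 / p = ennreal (1 / r)"
    using real r by (simp flip: divide_ennreal ennreal_1)
  thus ?thesis using real r that(2)[of r] by simp
next
  case top
  thus ?thesis using that(1) by simp
qed

lemma Lp_norm_le:
  assumes "Lp_bounded p M F K" "1 \<le> p"
  shows "Lp_norm p M F \<le> ennreal K"
  using assms(2)
proof (cases rule: ennreal_exponent_cases)
  case 1
  have [measurable]: "F \<in> borel_measurable M" using assms(1) by (simp add: Lp_bounded_def)
  show ?thesis
    using assms(1) 1 unfolding Lp_norm_def Lp_bounded_def
    by (auto intro!: esssup_I AE_I2 ennreal_leI)
next
  case (2 r)
  define J where "J = (\<integral>\<^sup>+x. ennreal (\<bar>F x\<bar> powr r) \<partial>M)"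
  have J: "J \<le> ennreal (K powr r)" "0 \<le> K"
    using assms(1) 2 by (auto simp: Lp_bounded_def J_def)
  hence "J \<noteq> \<infinity>" by (auto simp: top_unique)
  have "enn2real J \<le> K powr r"
    using J(1) by (simp add: enn2real_leI)
  hence "enn2real J powr (1 / r) \<le> (K powr r) powr (1 / r)"
    using 2 by (intro powr_mono2) auto
  also have "\<dots> = K" using 2 J(2) by (simp add: powr_powr)
  finally show ?thesis
    using \<open>J \<noteq> \<infinity>\<close> 2 unfolding Lp_norm_def by (simp add: Let_def J_def[symmetric] ennreal_leI)
qed

lemma Lp_bounded_mono:
  assumes "Lp_bounded p M G K" "F \<in> borel_measurable M" "K \<le> K'" "1 \<le> p"
    and "\<And>x. x \<in> space M \<Longrightarrow> \<bar>F x\<bar> \<le> \<bar>G x\<bar>"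
  shows "Lp_bounded p M F K'"
  using assms(4)
proof (cases rule: ennreal_exponent_cases)
  case 1
  have "\<bar>F x\<bar> \<le> K'" if "x \<in> space M" for x
    using assms(1,3) assms(5)[OF that] 1 that unfolding Lp_bounded_def by fastforce
  thus ?thesis using assms 1 unfolding Lp_bounded_def by auto
next
  case (2 r)
  have "(\<integral>\<^sup>+x. ennreal (\<bar>F x\<bar> powr r) \<partial>M) \<le> (\<integral>\<^sup>+x. ennreal (\<bar>G x\<bar> powr r) \<partial>M)"
    using assms(5) 2 by (intro nn_integral_mono ennreal_leI powr_mono2) auto
  also have "\<dots> \<le> ennreal (K powr r)" using assms(1) 2 by (auto simp: Lp_bounded_def)
  also have "\<dots> \<le> ennreal (K' powr r)"
    using assms(1,3) 2 by (intro ennreal_leI powr_mono2) (auto simp: Lp_bounded_def)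
  finally show ?thesis using assms 2 by (auto simp: Lp_bounded_def)
qed

text \<open>A crude form of Minkowski's inequality, enough because constants are immaterial. One
  factor 2 comes from bounding a sum by twice the maximum, the other from adding two powers, as
  \<open>2 \<le> 2 powr r\<close>.\<close>

lemma Lp_bounded_add:
  assumes "Lp_bounded p M F K" "Lp_bounded p M G K'" "1 \<le> p"
  shows "Lp_bounded p M (\<lambda>x. F x + G x) (4 * (K + K'))"
  using assms(3)
proof (cases rule: ennreal_exponent_cases)
  case 1
  have "\<bar>F x + G x\<bar> \<le> 4 * (K + K')" if "x \<in> space M" for x
    using assms 1 that abs_triangle_ineq[of "F x" "G x"]
    unfolding Lp_bounded_def by fastforce
  thus ?thesis using assms 1 unfolding Lp_bounded_def by auto
next
  case (2 r)
  have [measurable]: "F \<in> borel_measurable M" "G \<in> borel_measurable M" and K: "0 \<le> K" "0 \<le> K'"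
    using assms by (auto simp: Lp_bounded_def)
  have le: "\<bar>u + v\<bar> powr r \<le> 2 powr r * (\<bar>u\<bar> powr r + \<bar>v\<bar> powr r)" for u v :: real
  proof -
    have "\<bar>u + v\<bar> powr r \<le> (2 * max \<bar>u\<bar> \<bar>v\<bar>) powr r" using 2 by (intro powr_mono2) auto
    also have "\<dots> = 2 powr r * max \<bar>u\<bar> \<bar>v\<bar> powr r" by (simp add: powr_mult)
    also have "\<dots> \<le> 2 powr r * (\<bar>u\<bar> powr r + \<bar>v\<bar> powr r)"
      by (intro mult_left_mono) (auto simp: max_def)
    finally show ?thesis .
  qed
  have "(\<integral>\<^sup>+x. ennreal (\<bar>F x + G x\<bar> powr r) \<partial>M)
      \<le> (\<integral>\<^sup>+x. ennreal (2 powr r) * (ennreal (\<bar>F x\<bar> powr r) + ennreal (\<bar>G x\<bar> powr r)) \<partial>M)"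
    by (intro nn_integral_mono) (simp add: ennreal_leI le flip: ennreal_plus ennreal_mult)
  also have "\<dots> = ennreal (2 powr r) *
      ((\<integral>\<^sup>+x. ennreal (\<bar>F x\<bar> powr r) \<partial>M) + (\<integral>\<^sup>+x. ennreal (\<bar>G x\<bar> powr r) \<partial>M))"
    by (simp add: nn_integral_cmult nn_integral_add)
  also have "\<dots> \<le> ennreal (2 powr r) * (ennreal (K powr r) + ennreal (K' powr r))"
    using assms 2 by (intro mult_left_mono add_mono) (auto simp: Lp_bounded_def)
  also have "\<dots> = ennreal (2 powr r * (K powr r + K' powr r))"
    by (simp flip: ennreal_plus ennreal_mult)
  also have "\<dots> \<le> ennreal ((4 * (K + K')) powr r)"
  proof (rule ennreal_leI)
    have "K powr r + K' powr r \<le> 2 * (K + K') powr r"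
      using powr_mono2[of r K "K + K'"] powr_mono2[of r K' "K + K'"] K 2 by simp
    also have "\<dots> \<le> 2 powr r * (K + K') powr r"
      using 2 powr_mono[of 1 r 2] by (intro mult_right_mono) auto
    finally have "2 powr r * (K powr r + K' powr r) \<le> 2 powr r * (2 powr r * (K + K') powr r)"
      by (intro mult_left_mono) auto
    also have "\<dots> = (4 * (K + K')) powr r"
      using K by (simp add: powr_mult flip: mult.assoc) (simp flip: powr_mult)
    finally show "2 powr r * (K powr r + K' powr r) \<le> (4 * (K + K')) powr r" .
  qed
  finally show ?thesis using K 2 unfolding Lp_bounded_def by simp
qed

interpretation lborel_product: product_sigma_finite "\<lambda>_. lborel :: real measure" ..

text \<open>The product of envelopes lies between 0 and 1, so its r-th power is at most itself; its
  integral then factorises into one-dimensional Gaussian integrals, each contributing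
  \<open>h j\<close>. For infinite p the exponent of the volume is 0, in agreement with the
  pointwise bound.\<close>

lemma Lp_bounded_envelope_prod:
  assumes "finite I" "\<And>j. j \<in> I \<Longrightarrow> 0 < h j" "0 \<le> K" "1 \<le> p"
    and F: "F \<in> borel_measurable (leb I)"
    and le: "\<And>x. x \<in> space (leb I) \<Longrightarrow> \<bar>F x\<bar> \<le> K * (\<Prod>j\<in>I. envelope ((x j - a j) / h j))"
  shows "Lp_bounded p (leb I) F (K * envelope_mass ^ card I * (\<Prod>j\<in>I. h j) powr enn2real (1 / p))"
proof -
  define V where "V = (\<Prod>j\<in>I. h j)"
  define E where "E x = (\<Prod>j\<in>I. envelope ((x j - a j) / h j))" for x
  have V: "0 < V" unfolding V_def using assms(2) by (intro prod_pos) auto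
  have E: "0 \<le> E x" "E x \<le> 1" for x
    unfolding E_def
    by (auto intro!: prod_nonneg prod_le_1 less_imp_le[OF envelope_pos]) (simp add: envelope_def)
  have m1: "1 \<le> envelope_mass ^ card I"
    using envelope_has_integral(2) by simp
  show ?thesis
    using assms(4)
  proof (cases rule: ennreal_exponent_cases)
    case 1
    have "\<bar>F x\<bar> \<le> K * envelope_mass ^ card I" if "x \<in> space (leb I)" for x
    proof -
      have "\<bar>F x\<bar> \<le> K * E x" using le[OF that] by (simp add: E_def)
      also have "\<dots> \<le> K * envelope_mass ^ card I"
        using E(2)[of x] m1 assms(3) by (intro mult_left_mono) auto
      finally show ?thesis .
    qed
    thus ?thesis using 1 V F assms(3) m1 unfolding Lp_bounded_def V_def by simp
  next
    case (2 r)
    have "\<bar>F x\<bar> powr r \<le> K powr r * E x" if "x \<in> space (leb I)" for x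
    proof -
      have "\<bar>F x\<bar> powr r \<le> (K * E x) powr r"
        using le[OF that] 2 by (intro powr_mono2) (auto simp: E_def)
      also have "\<dots> = K powr r * E x powr r" using assms(3) E by (simp add: powr_mult)
      also have "\<dots> \<le> K powr r * E x"
        using E[of x] 2 powr_mono'[of 1 r "E x"] by (intro mult_left_mono) auto
      finally show ?thesis .
    qed
    hence "(\<integral>\<^sup>+x. ennreal (\<bar>F x\<bar> powr r) \<partial>leb I) \<le> (\<integral>\<^sup>+x. ennreal (K powr r * E x) \<partial>leb I)"
      by (intro nn_integral_mono ennreal_leI) auto
    also have "\<dots> = (\<integral>\<^sup>+x. ennreal (K powr r) * (\<Prod>j\<in>I. ennreal (envelope ((x j - a j) / h j))) \<partial>leb I)"
      by (simp add: E_def ennreal_mult prod_nonneg prod_ennreal less_imp_le[OF envelope_pos])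
    also have "\<dots> = ennreal (K powr r) * (\<Prod>j\<in>I. \<integral>\<^sup>+y. ennreal (envelope ((y - a j) / h j)) \<partial>lborel)"
      using assms(1) lborel_product.product_nn_integral_prod
          [of I "\<lambda>j y. ennreal (envelope ((y - a j) / h j))"]
      by (subst nn_integral_cmult) auto
    also have "\<dots> = ennreal (K powr r) * (\<Prod>j\<in>I. ennreal (h j * envelope_mass))"
      using assms(2) envelope_has_integral(2)
      by (intro arg_cong2[where f = "(*)"] prod.cong refl)
        (simp add: nn_integral_rescale[of "\<lambda>y. ennreal (envelope y)"] nn_integral_envelope
          less_imp_le ennreal_mult)
    also have "\<dots> = ennreal (K powr r * (V * envelope_mass ^ card I))"
      using assms(2) envelope_has_integral(2) V
      by (subst prod_ennreal) (auto simp: V_def prod.distrib less_imp_le simp flip: ennreal_mult)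
    also have "\<dots> \<le> ennreal ((K * envelope_mass ^ card I * V powr (1 / r)) powr r)"
    proof (rule ennreal_leI)
      have "envelope_mass ^ card I \<le> (envelope_mass ^ card I) powr r"
        using powr_mono[of 1 r "envelope_mass ^ card I"] 2 m1 by simp
      hence "K powr r * (V * envelope_mass ^ card I) \<le> K powr r * (V * (envelope_mass ^ card I) powr r)"
        using V by (intro mult_left_mono) auto
      also have "\<dots> = (K * envelope_mass ^ card I * V powr (1 / r)) powr r"
        using V 2 assms(3) m1 by (simp add: powr_mult powr_powr)
      finally show "K powr r * (V * envelope_mass ^ card I)
          \<le> (K * envelope_mass ^ card I * V powr (1 / r)) powr r" .
    qed
    finally show ?thesis
      using 2 F assms(3) m1 unfolding Lp_bounded_def V_def by simp
  qed
qed

section \<open>Partial derivatives and increments of product bumps at two scales\<close>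

lemma iterated_deriv_gauss_poly_sum:
  fixes a h0 h1 c0 c1 :: real
  assumes "0 < h0" "0 < h1"
  shows "(deriv ^^ k) (\<lambda>t. c0 * gauss_poly P0 ((t - a) / h0) + c1 * gauss_poly P1 ((t - a) / h1))
    = (\<lambda>t. c0 / h0 ^ k * gauss_poly ((gauss_poly_deriv ^^ k) P0) ((t - a) / h0)
          + c1 / h1 ^ k * gauss_poly ((gauss_poly_deriv ^^ k) P1) ((t - a) / h1))"
    and "(\<lambda>t. c0 * gauss_poly P0 ((t - a) / h0) + c1 * gauss_poly P1 ((t - a) / h1))
           differentiable (at s)"
proof -
  have scaled: "((\<lambda>t. gauss_poly P ((t - a) / h)) has_real_derivative
      gauss_poly (gauss_poly_deriv P) ((s - a) / h) * (1 / h)) (at s)" if "0 < h" for P h s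
    using that by (intro DERIV_chain2[OF DERIV_gauss_poly]) (auto intro!: derivative_eq_intros)
  have D: "((\<lambda>t. c0 * gauss_poly P0 ((t - a) / h0) + c1 * gauss_poly P1 ((t - a) / h1))
      has_real_derivative
        (c0 / h0 * gauss_poly (gauss_poly_deriv P0) ((s - a) / h0)
        + c1 / h1 * gauss_poly (gauss_poly_deriv P1) ((s - a) / h1))) (at s)" for c0 c1 P0 P1 s
    by (rule DERIV_cong[OF DERIV_add[OF DERIV_cmult[OF scaled] DERIV_cmult[OF scaled]]])
      (use assms in auto)
  show "(deriv ^^ k) (\<lambda>t. c0 * gauss_poly P0 ((t - a) / h0) + c1 * gauss_poly P1 ((t - a) / h1))
    = (\<lambda>t. c0 / h0 ^ k * gauss_poly ((gauss_poly_deriv ^^ k) P0) ((t - a) / h0)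
          + c1 / h1 ^ k * gauss_poly ((gauss_poly_deriv ^^ k) P1) ((t - a) / h1))"
  proof (induction k)
    case (Suc k)
    show ?case
      unfolding funpow.simps comp_def Suc
      by (rule ext, rule DERIV_imp_deriv, rule DERIV_cong[OF D]) (simp add: mult.commute)
  qed simp
  show "(\<lambda>t. c0 * gauss_poly P0 ((t - a) / h0) + c1 * gauss_poly P1 ((t - a) / h1))
      differentiable (at s)"
    using D[of c0 P0 c1 P1 s] by (auto simp: real_differentiable_def)
qed

definition bump :: "nat set \<Rightarrow> real poly \<Rightarrow> (nat \<Rightarrow> real) \<Rightarrow> (nat \<Rightarrow> real) \<Rightarrow> (nat \<Rightarrow> real) \<Rightarrow> real" where
  "bump I P a h x = (\<Prod>j\<in>I. gauss_poly P ((x j - a j) / h j))"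

text \<open>The k-th partial derivative of the bump in direction \<open>i\<close>, except that the
  chain rule factor \<open>h i\<close> to the power -k is left out, so that the dependence on the
  scale stays visible.\<close>

definition bump_deriv ::
  "nat set \<Rightarrow> nat \<Rightarrow> nat \<Rightarrow> real poly \<Rightarrow> (nat \<Rightarrow> real) \<Rightarrow> (nat \<Rightarrow> real) \<Rightarrow> (nat \<Rightarrow> real) \<Rightarrow> real"
  where
  "bump_deriv I i k P a h x = gauss_poly ((gauss_poly_deriv ^^ k) P) ((x i - a i) / h i)
     * (\<Prod>j\<in>I - {i}. gauss_poly P ((x j - a j) / h j))"

lemma bump_measurable [measurable]: "bump I P a h \<in> borel_measurable (leb I)"
  unfolding bump_def by measurable

lemma bump_deriv_measurable [measurable]:
  assumes [measurable]: "i \<in> I" shows "bump_deriv I i k P a h \<in> borel_measurable (leb I)"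
  unfolding bump_deriv_def by measurable

lemma bump_slice:
  assumes "finite I" "i \<in> I"
  shows "bump I P a h (x(i := t))
    = (\<Prod>j\<in>I - {i}. gauss_poly P ((x j - a j) / h j)) * gauss_poly P ((t - a i) / h i)"
proof -
  have "(\<Prod>j\<in>I - {i}. gauss_poly P (((x(i := t)) j - a j) / h j))
      = (\<Prod>j\<in>I - {i}. gauss_poly P ((x j - a j) / h j))"
    by (intro prod.cong) auto
  thus ?thesis unfolding bump_def prod.remove[OF assms] by simp
qed

lemma
  fixes A0 A1 :: real
  assumes I: "finite I" "i \<in> I" and h: "0 < h0 i" "0 < h1 i"
    and F: "F = (\<lambda>x. A0 * bump I P0 a h0 x + A1 * bump I P1 a h1 x)"
  shows partial_deriv_bump_sum: "partial_deriv i k F x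
      = A0 / h0 i ^ k * bump_deriv I i k P0 a h0 x + A1 / h1 i ^ k * bump_deriv I i k P1 a h1 x"
    and partial_derivs_exist_bump_sum: "partial_derivs_exist I i m F"
proof -
  define B0 where "B0 x = (\<Prod>j\<in>I - {i}. gauss_poly P0 ((x j - a j) / h0 j))" for x
  define B1 where "B1 x = (\<Prod>j\<in>I - {i}. gauss_poly P1 ((x j - a j) / h1 j))" for x
  have slice: "(\<lambda>t. F (x(i := t))) = (\<lambda>t. A0 * B0 x * gauss_poly P0 ((t - a i) / h0 i)
      + A1 * B1 x * gauss_poly P1 ((t - a i) / h1 i))" for x
    unfolding F B0_def B1_def by (simp add: bump_slice[OF I] mult_ac)
  show "partial_deriv i k F x
      = A0 / h0 i ^ k * bump_deriv I i k P0 a h0 x + A1 / h1 i ^ k * bump_deriv I i k P1 a h1 x"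
    unfolding partial_deriv_def slice iterated_deriv_gauss_poly_sum(1)[OF h]
    by (simp add: bump_deriv_def B0_def B1_def mult_ac)
  show "partial_derivs_exist I i m F"
    unfolding partial_derivs_exist_def slice iterated_deriv_gauss_poly_sum(1)[OF h]
    by (intro ballI allI impI iterated_deriv_gauss_poly_sum(2)[OF h])
qed

text \<open>One constant for all polynomials that arise by differentiating the null and the spike;
  it is fixed before any scale is chosen.\<close>

lemma gauss_poly_family_bound:
  assumes "finite S"
  shows "\<exists>C\<ge>1. \<forall>P\<in>S. (\<forall>x. \<bar>gauss_poly P x\<bar> \<le> C * envelope x) \<and>
    (\<forall>\<alpha> t x. 0 \<le> \<alpha> \<and> \<alpha> \<le> 1 \<longrightarrow>
      \<bar>gauss_poly P (x + t) - gauss_poly P x\<bar> \<le> C * (\<bar>t\<bar> powr \<alpha> * (envelope x + envelope (x + t))))"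
  using assms
proof (induction S)
  case empty
  show ?case by (intro exI[of _ 1]) simp
next
  case (insert P S)
  obtain C where C: "1 \<le> C" "\<And>P x. P \<in> S \<Longrightarrow> \<bar>gauss_poly P x\<bar> \<le> C * envelope x"
    "\<And>P \<alpha> t x. P \<in> S \<Longrightarrow> 0 \<le> \<alpha> \<Longrightarrow> \<alpha> \<le> 1 \<Longrightarrow>
      \<bar>gauss_poly P (x + t) - gauss_poly P x\<bar> \<le> C * (\<bar>t\<bar> powr \<alpha> * (envelope x + envelope (x + t)))"
    using insert.IH by blast
  obtain C0 where C0: "1 \<le> C0" "\<And>x. \<bar>gauss_poly P x\<bar> \<le> C0 * envelope x"
    by (rule gauss_poly_bound[of P]) blast
  obtain C1 where C1: "1 \<le> C1" "\<And>\<alpha> t x. 0 \<le> \<alpha> \<Longrightarrow> \<alpha> \<le> 1 \<Longrightarrow>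
      \<bar>gauss_poly P (x + t) - gauss_poly P x\<bar> \<le> C1 * \<bar>t\<bar> powr \<alpha> * (envelope x + envelope (x + t))"
    by (rule gauss_poly_modulus_bound[of P]) blast
  define C' where "C' = C + C0 + C1"
  have le: "C * y \<le> C' * y" "C0 * y \<le> C' * y" "C1 * y \<le> C' * y" if "0 \<le> y" for y
    unfolding C'_def using C(1) C0(1) C1(1) that by (auto intro!: mult_right_mono)
  have nonneg: "0 \<le> envelope x" "0 \<le> \<bar>t\<bar> powr \<alpha> * (envelope x + envelope (x + t))" for x t \<alpha>
    using envelope_pos[of x] envelope_pos[of "x + t"] by (auto intro!: mult_nonneg_nonneg)
  show ?case
  proof (intro exI[of _ C'] conjI ballI allI impI)
    show "1 \<le> C'" using C(1) C0(1) C1(1) by (simp add: C'_def)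
    fix Q x assume Q: "Q \<in> insert P S"
    show "\<bar>gauss_poly Q x\<bar> \<le> C' * envelope x"
      using Q C(2)[of Q x] C0(2)[of x] le(1,2)[OF nonneg(1)[of x]] by (cases "Q = P") auto
    fix \<alpha> t :: real assume "0 \<le> \<alpha> \<and> \<alpha> \<le> 1"
    hence "\<bar>gauss_poly Q (x + t) - gauss_poly Q x\<bar>
        \<le> C * (\<bar>t\<bar> powr \<alpha> * (envelope x + envelope (x + t))) \<or>
      \<bar>gauss_poly Q (x + t) - gauss_poly Q x\<bar>
        \<le> C1 * (\<bar>t\<bar> powr \<alpha> * (envelope x + envelope (x + t)))"
      using Q C(3)[of Q \<alpha> x t] C1(2)[of \<alpha> x t] by (auto simp: mult.assoc)
    thus "\<bar>gauss_poly Q (x + t) - gauss_poly Q x\<bar>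
        \<le> C' * (\<bar>t\<bar> powr \<alpha> * (envelope x + envelope (x + t)))"
      using le[OF nonneg(2)] by (meson order_trans)
  qed
qed

lemma bump_deriv_bound:
  assumes I: "finite I" "i \<in> I" and C: "1 \<le> C"
    and k: "\<And>x. \<bar>gauss_poly ((gauss_poly_deriv ^^ k) P) x\<bar> \<le> C * envelope x"
    and P: "\<And>x. \<bar>gauss_poly P x\<bar> \<le> C * envelope x"
  shows "\<bar>bump_deriv I i k P a h x\<bar> \<le> C ^ card I * (\<Prod>j\<in>I. envelope ((x j - a j) / h j))"
proof -
  have "\<bar>bump_deriv I i k P a h x\<bar> \<le> (C * envelope ((x i - a i) / h i)) *
      (\<Prod>j\<in>I - {i}. C * envelope ((x j - a j) / h j))"
    unfolding bump_deriv_def abs_mult abs_prod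
    using C by (intro mult_mono prod_mono k conjI P prod_nonneg mult_nonneg_nonneg)
      (auto simp: envelope_pos less_imp_le)
  also have "\<dots> = (\<Prod>j\<in>I. C * envelope ((x j - a j) / h j))"
    unfolding prod.remove[OF I] by simp
  finally show ?thesis by (simp add: prod.distrib)
qed

text \<open>The shift of the argument by \<open>t\<close> is moved into the centre \<open>a\<close>.
  The second envelope product then has the same form as the first and, by translation invariance,
  the same norm bound.\<close>

lemma bump_deriv_increment_bound:
  assumes I: "finite I" "i \<in> I" and C: "1 \<le> C" and h: "0 < h i"
    and k: "\<And>t x. \<bar>gauss_poly ((gauss_poly_deriv ^^ k) P) (x + t) - gauss_poly ((gauss_poly_deriv ^^ k) P) x\<bar>
        \<le> C * (\<bar>t\<bar> powr \<alpha> * (envelope x + envelope (x + t)))"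
    and P: "\<And>x. \<bar>gauss_poly P x\<bar> \<le> C * envelope x"
  shows "\<bar>bump_deriv I i k P a h (x(i := x i + t)) - bump_deriv I i k P a h x\<bar>
    \<le> C ^ card I * (\<bar>t\<bar> / h i) powr \<alpha> *
      ((\<Prod>j\<in>I. envelope ((x j - a j) / h j)) + (\<Prod>j\<in>I. envelope ((x j - (a(i := a i - t)) j) / h j)))"
    (is "_ \<le> _ * _ * (?E + ?E')")
proof -
  define Q where "Q = (\<Prod>j\<in>I - {i}. gauss_poly P ((x j - a j) / h j))"
  define R where "R = (\<Prod>j\<in>I - {i}. envelope ((x j - a j) / h j))"
  define z where "z = (x i - a i) / h i"
  have "(\<Prod>j\<in>I - {i}. gauss_poly P (((x(i := x i + t)) j - a j) / h j)) = Q"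
    unfolding Q_def by (intro prod.cong) auto
  moreover have "((x i + t) - a i) / h i = z + t / h i"
    by (simp add: z_def add_divide_distrib diff_divide_distrib)
  ultimately have eq: "bump_deriv I i k P a h (x(i := x i + t)) - bump_deriv I i k P a h x
    = (gauss_poly ((gauss_poly_deriv ^^ k) P) (z + t / h i) - gauss_poly ((gauss_poly_deriv ^^ k) P) z) * Q"
    unfolding bump_deriv_def Q_def[symmetric] z_def[symmetric] by (simp add: left_diff_distrib Q_def[symmetric] z_def)
  have "\<bar>Q\<bar> \<le> (\<Prod>j\<in>I - {i}. C * envelope ((x j - a j) / h j))"
    unfolding Q_def abs_prod by (intro prod_mono conjI P) auto
  hence Q: "\<bar>Q\<bar> \<le> C ^ (card I - 1) * R"
    using I by (simp add: prod.distrib R_def)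
  have R: "0 \<le> R" unfolding R_def by (intro prod_nonneg) (simp add: envelope_pos less_imp_le)
  have E: "?E = envelope z * R"
    unfolding prod.remove[OF I] R_def z_def by simp
  have "(\<Prod>j\<in>I - {i}. envelope ((x j - (a(i := a i - t)) j) / h j)) = R"
    unfolding R_def by (intro prod.cong) auto
  moreover have "(x i - (a i - t)) / h i = z + t / h i"
    by (simp add: z_def add_divide_distrib diff_divide_distrib)
  ultimately have E': "?E' = envelope (z + t / h i) * R"
    unfolding prod.remove[OF I] by simp
  have "card I = Suc (card I - 1)" using I by (metis Suc_pred' card_gt_0_iff empty_iff)
  hence CC: "C ^ card I = C * C ^ (card I - 1)" by (metis power_Suc)
  have "\<bar>bump_deriv I i k P a h (x(i := x i + t)) - bump_deriv I i k P a h x\<bar>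
     \<le> (C * (\<bar>t / h i\<bar> powr \<alpha> * (envelope z + envelope (z + t / h i)))) * (C ^ (card I - 1) * R)"
    unfolding eq abs_mult using C R k[of z "t / h i"] by (intro mult_mono k Q) auto
  also have "\<dots> = C ^ card I * (\<bar>t\<bar> / h i) powr \<alpha> * (?E + ?E')"
    unfolding E E' CC using h by (simp add: algebra_simps)
  finally show ?thesis .
qed

text \<open>The orders at which a Nikolskii norm has to be controlled by scaling.  Order \<open>0\<close> is left out
  for \<open>p\<^sub>i = 1\<close>, since the \<open>L\<^sub>1\<close> norm of a density is \<open>1\<close> at every scale.\<close>
definition norm_order :: "(nat \<Rightarrow> ennreal) \<Rightarrow> (nat \<Rightarrow> real) \<Rightarrow> nat \<Rightarrow> real set" where
  "norm_order p \<beta> i = insert (\<beta> i) (real ` {1..strict_floor (\<beta> i)}) \<union> (if p i = 1 then {} else {0})"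

text \<open>The order of quantifiers matters: \<open>C\<close> precedes amplitudes, scales, centre
  and \<open>L\<close>, since the scales will depend on n. The order \<open>\<beta> i\<close> stands
  for the Hoelder condition. For \<open>p i = 1\<close> the norm of order 0 is a hypothesis, because
  scaling cannot make it small.\<close>

lemma bump_sum_nikolskii:
  assumes I: "finite I" and \<beta>: "\<And>i. i \<in> I \<Longrightarrow> 0 < \<beta> i" and p: "\<And>i. i \<in> I \<Longrightarrow> 1 \<le> p i"
  shows "\<exists>C>0. \<forall>A0 A1 h0 h1 a L. 0 \<le> A0 \<longrightarrow> 0 \<le> A1 \<longrightarrow> (\<forall>j\<in>I. 0 < h0 j \<and> 0 < h1 j) \<longrightarrow>
    (\<forall>i\<in>I. \<forall>s\<in>norm_order p \<beta> i.
       C * (A0 * h0 i powr (-s) * (\<Prod>j\<in>I. h0 j) powr enn2real (1 / p i)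
          + A1 * h1 i powr (-s) * (\<Prod>j\<in>I. h1 j) powr enn2real (1 / p i)) \<le> L i) \<longrightarrow>
    (\<forall>i\<in>I. p i = 1 \<longrightarrow>
       Lp_norm 1 (leb I) (\<lambda>x. A0 * bump I P0 a h0 x + A1 * bump I P1 a h1 x) \<le> ennreal (L i)) \<longrightarrow>
    (\<lambda>x. A0 * bump I P0 a h0 x + A1 * bump I P1 a h1 x) \<in> nikolskii I p \<beta> L"
proof -
  \<comment> \<open>Only one factor of a bump is differentiated, so the undifferentiated polynomials
    are needed as well.\<close>
  define S where "S = (\<Union>i\<in>I. \<Union>k\<le>strict_floor (\<beta> i). \<Union>P\<in>{P0, P1}. {P, (gauss_poly_deriv ^^ k) P})"
  have "finite S" unfolding S_def using I by auto
  from gauss_poly_family_bound[OF this] obtain Cb where Cb: "1 \<le> Cb"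
    "\<And>P x. P \<in> S \<Longrightarrow> \<bar>gauss_poly P x\<bar> \<le> Cb * envelope x"
    "\<And>P \<alpha> t x. P \<in> S \<Longrightarrow> 0 \<le> \<alpha> \<Longrightarrow> \<alpha> \<le> 1 \<Longrightarrow>
      \<bar>gauss_poly P (x + t) - gauss_poly P x\<bar> \<le> Cb * (\<bar>t\<bar> powr \<alpha> * (envelope x + envelope (x + t)))"
    by blast
  define C1 where "C1 = Cb ^ card I * envelope_mass ^ card I"
  have C1: "0 < C1" unfolding C1_def using Cb(1) envelope_has_integral(2) by auto
  have deriv_bounded: "Lp_bounded (p i) (leb I) (\<lambda>x. A / h i ^ k * bump_deriv I i k P a h x)
      (C1 * (A * h i powr (- real k) * (\<Prod>j\<in>I. h j) powr enn2real (1 / p i)))"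
    if i: "i \<in> I" and P: "P \<in> {P0, P1}" and k: "k \<le> strict_floor (\<beta> i)" and A: "0 \<le> A"
      and h: "\<And>j. j \<in> I \<Longrightarrow> 0 < h j" for i P k A h a
  proof -
    have "Lp_bounded (p i) (leb I) (\<lambda>x. A / h i ^ k * bump_deriv I i k P a h x)
        (A / h i ^ k * Cb ^ card I * envelope_mass ^ card I * (\<Prod>j\<in>I. h j) powr enn2real (1 / p i))"
    proof (rule Lp_bounded_envelope_prod)
      have "P \<in> S" "(gauss_poly_deriv ^^ k) P \<in> S" using i P k unfolding S_def by blast+
      hence "\<bar>bump_deriv I i k P a h x\<bar> \<le> Cb ^ card I * (\<Prod>j\<in>I. envelope ((x j - a j) / h j))" for x
        using Cb I i by (intro bump_deriv_bound) auto
      thus "\<bar>A / h i ^ k * bump_deriv I i k P a h x\<bar>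
          \<le> A / h i ^ k * Cb ^ card I * (\<Prod>j\<in>I. envelope ((x j - a j) / h j))" for x
        using A h[OF i] by (simp add: abs_mult mult.assoc mult_left_mono divide_right_mono)
      show "(\<lambda>x. A / h i ^ k * bump_deriv I i k P a h x) \<in> borel_measurable (leb I)"
        using i by measurable
      show "0 \<le> A / h i ^ k * Cb ^ card I"
        using A Cb(1) h[OF i] by (intro mult_nonneg_nonneg divide_nonneg_nonneg) auto
    qed (use I h p i in auto)
    thus ?thesis
      using h[OF i] by (simp add: C1_def powr_minus powr_realpow divide_inverse mult_ac)
  qed
  have incr_bounded: "Lp_bounded (p i) (leb I)
      (\<lambda>x. A / h i ^ m * (bump_deriv I i m P a h (x(i := x i + t)) - bump_deriv I i m P a h x))
      (8 * C1 * (A * h i powr (- \<beta> i) * (\<Prod>j\<in>I. h j) powr enn2real (1 / p i)) * \<bar>t\<bar> powr (\<beta> i - real m))"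
    if i: "i \<in> I" and P: "P \<in> {P0, P1}" and m: "m = strict_floor (\<beta> i)" and A: "0 \<le> A"
      and h: "\<And>j. j \<in> I \<Longrightarrow> 0 < h j" for i P m A h a t
  proof -
    define \<alpha> where "\<alpha> = \<beta> i - real m"
    \<comment> \<open>The remaining smoothness \<alpha> lies in (0,1]. The value 1 occurs for
      integer \<open>\<beta> i\<close>, since \<open>strict_floor\<close> is strictly below
      it.\<close>
    have "\<not> real m + 1 < \<beta> i"
      using strict_floor_greatest(2)[OF \<beta>[OF i], of "int m + 1"] unfolding m by auto
    hence \<alpha>: "0 \<le> \<alpha>" "\<alpha> \<le> 1"
      using strict_floor_greatest(1)[OF \<beta>[OF i]] unfolding \<alpha>_def m by auto
    define K where "K = A / h i ^ m * Cb ^ card I * (\<bar>t\<bar> / h i) powr \<alpha>"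
    have K: "0 \<le> K" unfolding K_def using A Cb(1) h[OF i] by auto
    define F where "F b x = K * (\<Prod>j\<in>I. envelope ((x j - b j) / h j))" for b x
    have F: "Lp_bounded (p i) (leb I) (F b)
        (K * envelope_mass ^ card I * (\<Prod>j\<in>I. h j) powr enn2real (1 / p i))" for b
    proof (rule Lp_bounded_envelope_prod)
      show "F b \<in> borel_measurable (leb I)" unfolding F_def by measurable
      show "\<bar>F b x\<bar> \<le> K * (\<Prod>j\<in>I. envelope ((x j - b j) / h j))" for x
        unfolding F_def using K by (simp add: abs_mult abs_prod envelope_pos less_imp_le)
    qed (use I h p i K in auto)
    have "P \<in> S" "(gauss_poly_deriv ^^ m) P \<in> S" using i P m unfolding S_def by blast+
    hence B: "\<bar>bump_deriv I i m P a h (x(i := x i + t)) - bump_deriv I i m P a h x\<bar>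
        \<le> Cb ^ card I * (\<bar>t\<bar> / h i) powr \<alpha> * ((\<Prod>j\<in>I. envelope ((x j - a j) / h j))
          + (\<Prod>j\<in>I. envelope ((x j - (a(i := a i - t)) j) / h j)))" for x
      using Cb I i h \<alpha> by (intro bump_deriv_increment_bound) auto
    have le: "\<bar>A / h i ^ m * (bump_deriv I i m P a h (x(i := x i + t)) - bump_deriv I i m P a h x)\<bar>
        \<le> \<bar>F a x + F (a(i := a i - t)) x\<bar>" for x
    proof -
      have "\<bar>A / h i ^ m * (bump_deriv I i m P a h (x(i := x i + t)) - bump_deriv I i m P a h x)\<bar>
         \<le> A / h i ^ m * (Cb ^ card I * (\<bar>t\<bar> / h i) powr \<alpha> * ((\<Prod>j\<in>I. envelope ((x j - a j) / h j))
          + (\<Prod>j\<in>I. envelope ((x j - (a(i := a i - t)) j) / h j))))"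
        unfolding abs_mult using A h[OF i] by (intro mult_mono B) auto
      also have "\<dots> = F a x + F (a(i := a i - t)) x"
        unfolding F_def K_def by (simp only: ring_distribs mult.assoc)
      finally show ?thesis by linarith
    qed
    show ?thesis
    proof (rule Lp_bounded_mono[OF Lp_bounded_add[OF F F]])
      have [measurable]: "(\<lambda>x. x(i := x i + t)) \<in> leb I \<rightarrow>\<^sub>M leb I"
        using i by (intro measurable_fun_upd[where J = I]) auto
      show "(\<lambda>x. A / h i ^ m * (bump_deriv I i m P a h (x(i := x i + t)) - bump_deriv I i m P a h x))
          \<in> borel_measurable (leb I)"
        using i by measurable
      \<comment> \<open>The powers -m from the derivative and -\<alpha> from the increment add up to
        -\<beta>.\<close>
      have "K = A * h i powr (- \<beta> i) * Cb ^ card I * \<bar>t\<bar> powr (\<beta> i - real m)"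
        unfolding K_def \<alpha>_def using h[OF i]
        by (simp add: powr_divide powr_diff powr_minus powr_realpow field_simps)
      thus "4 * (K * envelope_mass ^ card I * (\<Prod>j\<in>I. h j) powr enn2real (1 / p i)
            + K * envelope_mass ^ card I * (\<Prod>j\<in>I. h j) powr enn2real (1 / p i))
          \<le> 8 * C1 * (A * h i powr (- \<beta> i) * (\<Prod>j\<in>I. h j) powr enn2real (1 / p i)) * \<bar>t\<bar> powr (\<beta> i - real m)"
        by (simp add: C1_def mult_ac)
    qed (use p i le in auto)
  qed
  show ?thesis
  \<comment> \<open>32 = 4 * 8: the 8 arises inside each increment, from adding the bounds at the
    two centres, and the 4 from adding the null and the spike. Plain derivatives need only the
    4.\<close>
  proof (intro exI[of _ "32 * C1"] conjI allI impI)
    fix A0 A1 :: real and h0 h1 a L :: "nat \<Rightarrow> real"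
    assume A: "0 \<le> A0" "0 \<le> A1" and h: "\<forall>j\<in>I. 0 < h0 j \<and> 0 < h1 j"
    define N where "N i s = A0 * h0 i powr (-s) * (\<Prod>j\<in>I. h0 j) powr enn2real (1 / p i)
          + A1 * h1 i powr (-s) * (\<Prod>j\<in>I. h1 j) powr enn2real (1 / p i)" for i s
    define F where "F = (\<lambda>x. A0 * bump I P0 a h0 x + A1 * bump I P1 a h1 x)"
    assume "\<forall>i\<in>I. \<forall>s\<in>norm_order p \<beta> i.
       32 * C1 * (A0 * h0 i powr (-s) * (\<Prod>j\<in>I. h0 j) powr enn2real (1 / p i)
          + A1 * h1 i powr (-s) * (\<Prod>j\<in>I. h1 j) powr enn2real (1 / p i)) \<le> L i"
    hence N: "32 * C1 * N i s \<le> L i" if "i \<in> I" "s \<in> norm_order p \<beta> i" for i s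
      using that unfolding N_def by blast
    have N0: "0 \<le> N i s" for i s unfolding N_def using A by (intro add_nonneg_nonneg) auto
    assume "\<forall>i\<in>I. p i = 1 \<longrightarrow>
       Lp_norm 1 (leb I) (\<lambda>x. A0 * bump I P0 a h0 x + A1 * bump I P1 a h1 x) \<le> ennreal (L i)"
    hence L1: "Lp_norm 1 (leb I) F \<le> ennreal (L i)" if "i \<in> I" "p i = 1" for i
      using that unfolding F_def by blast
    have "F \<in> nikolskii I p \<beta> L"
      unfolding nikolskii_def
    proof (intro CollectI conjI ballI allI impI)
      show "F \<in> borel_measurable (leb I)" unfolding F_def by measurable
      fix i assume i: "i \<in> I"
      have hi: "0 < h0 i" "0 < h1 i" "\<And>j. j \<in> I \<Longrightarrow> 0 < h0 j" "\<And>j. j \<in> I \<Longrightarrow> 0 < h1 j"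
        using h i by auto
      note pd = partial_deriv_bump_sum[OF I i hi(1,2) F_def]
      show "partial_derivs_exist I i (strict_floor (\<beta> i)) F"
        by (rule partial_derivs_exist_bump_sum[OF I i hi(1,2) F_def])
      show "Lp_norm (p i) (leb I) (partial_deriv i k F) \<le> ennreal (L i)"
        if k: "k \<le> strict_floor (\<beta> i)" for k
      proof (cases "k = 0 \<and> p i = 1")
        case True
        have "partial_deriv i 0 F = F" by (simp add: partial_deriv_def fun_eq_iff)
        thus ?thesis using True L1[OF i] by simp
      next
        case False
        hence "real k \<in> norm_order p \<beta> i" using k by (auto simp: norm_order_def)
        have "Lp_bounded (p i) (leb I) (partial_deriv i k F) (4 * (C1 * N i (real k)))"
          unfolding pd[abs_def] N_def distrib_left[of C1]
          by (intro Lp_bounded_add deriv_bounded i k A hi(3,4) p) auto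
        hence "Lp_norm (p i) (leb I) (partial_deriv i k F) \<le> ennreal (4 * (C1 * N i (real k)))"
          by (intro Lp_norm_le p i)
        also have "\<dots> \<le> ennreal (L i)"
        proof (rule ennreal_leI)
          have "0 \<le> C1 * N i (real k)" using C1 N0 by simp
          thus "4 * (C1 * N i (real k)) \<le> L i"
            using N[OF i \<open>real k \<in> norm_order p \<beta> i\<close>] by linarith
        qed
        finally show ?thesis .
      qed
      fix t :: real
      define m where "m = strict_floor (\<beta> i)"
      have "partial_deriv i m F (x(i := x i + t)) - partial_deriv i m F x
          = A0 / h0 i ^ m * (bump_deriv I i m P0 a h0 (x(i := x i + t)) - bump_deriv I i m P0 a h0 x)
          + A1 / h1 i ^ m * (bump_deriv I i m P1 a h1 (x(i := x i + t)) - bump_deriv I i m P1 a h1 x)" for x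
        unfolding pd by (simp add: algebra_simps)
      hence "Lp_bounded (p i) (leb I)
          (\<lambda>x. partial_deriv i m F (x(i := x i + t)) - partial_deriv i m F x)
          (4 * (8 * C1 * (A0 * h0 i powr (- \<beta> i) * (\<Prod>j\<in>I. h0 j) powr enn2real (1 / p i)) * \<bar>t\<bar> powr (\<beta> i - real m)
           + 8 * C1 * (A1 * h1 i powr (- \<beta> i) * (\<Prod>j\<in>I. h1 j) powr enn2real (1 / p i)) * \<bar>t\<bar> powr (\<beta> i - real m)))"
        by (simp only:) (intro Lp_bounded_add incr_bounded i m_def A hi(3,4) p; simp)
      hence "Lp_norm (p i) (leb I) (\<lambda>x. partial_deriv i m F (x(i := x i + t)) - partial_deriv i m F x)
          \<le> ennreal (32 * C1 * N i (\<beta> i) * \<bar>t\<bar> powr (\<beta> i - real m))"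
        using Lp_norm_le[OF _ p[OF i]] by (fastforce simp: N_def algebra_simps)
      also have "\<dots> \<le> ennreal (L i * \<bar>t\<bar> powr (\<beta> i - real m))"
        using N[OF i, of "\<beta> i"] by (intro ennreal_leI mult_right_mono) (auto simp: norm_order_def)
      finally show "Lp_norm (p i) (leb I) (\<lambda>x. partial_deriv i (strict_floor (\<beta> i)) F (x(i := x i + t))
            - partial_deriv i (strict_floor (\<beta> i)) F x)
          \<le> ennreal (L i * \<bar>t\<bar> powr (\<beta> i - real (strict_floor (\<beta> i))))"
        unfolding m_def .
    qed
    thus "(\<lambda>x. A0 * bump I P0 a h0 x + A1 * bump I P1 a h1 x) \<in> nikolskii I p \<beta> L"
      unfolding F_def .
  qed (use C1 in auto)
qed

section \<open>The two-point argument\<close>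

lemma leb_sigma_finite: "finite I \<Longrightarrow> sigma_finite_measure (leb I)"
  by (rule lborel_product.sigma_finite)

text \<open>The change of measure costs only \<open>x \<le> s / 2 + x\<^sup>2 / (2 * s)\<close> applied to the likelihood
  ratio, so that no Cauchy--Schwarz inequality is needed.\<close>
lemma two_point_prob:
  fixes F0 F1 :: "'a \<Rightarrow> real"
  assumes meas: "F0 \<in> borel_measurable M" "F1 \<in> borel_measurable M" "B \<in> sets M"
    and pos: "\<And>x. x \<in> space M \<Longrightarrow> 0 < F0 x" "\<And>x. x \<in> space M \<Longrightarrow> 0 \<le> F1 x"
    and K: "0 < K" "(\<integral>\<^sup>+x. ennreal ((F1 x)\<^sup>2 / F0 x) \<partial>M) \<le> ennreal K"
    and B: "ennreal (1 / 2) \<le> emeasure (density M (\<lambda>x. ennreal (F1 x))) B"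
  shows "ennreal (1 / (4 * K)) \<le> emeasure (density M (\<lambda>x. ennreal (F0 x))) B"
proof -
  note [measurable] = meas
  define b where "b = emeasure (density M (\<lambda>x. ennreal (F0 x))) B"
  have "ennreal (1 / 2) \<le> (\<integral>\<^sup>+x. ennreal (F1 x) * indicator B x \<partial>M)"
    using B by (simp add: emeasure_density)
  also have "\<dots> \<le> (\<integral>\<^sup>+x. ennreal K * (ennreal (F0 x) * indicator B x)
        + ennreal (1 / (4 * K)) * ennreal ((F1 x)\<^sup>2 / F0 x) \<partial>M)"
  proof (rule nn_integral_mono)
    fix x assume x: "x \<in> space M"
    \<comment> \<open>This is the choice s = 2 K: the second moment then accounts for 1/4 of the
      probability 1/2, and the other 1/4 is at most K times the probability under
      \<open>F0\<close>.\<close>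
    have "0 \<le> (2 * K * F0 x - F1 x)\<^sup>2" by simp
    hence "4 * K * F0 x * F1 x \<le> (2 * K * F0 x)\<^sup>2 + (F1 x)\<^sup>2"
      by (simp add: power2_eq_square algebra_simps)
    hence "F1 x \<le> K * F0 x + 1 / (4 * K) * ((F1 x)\<^sup>2 / F0 x)"
      using pos(1)[OF x] K(1) by (simp add: field_simps power2_eq_square)
    hence "ennreal (F1 x) \<le> ennreal K * ennreal (F0 x) + ennreal (1 / (4 * K)) * ennreal ((F1 x)\<^sup>2 / F0 x)"
      using pos[OF x] K(1) by (simp flip: ennreal_mult ennreal_plus add: ennreal_leI)
    thus "ennreal (F1 x) * indicator B x \<le> ennreal K * (ennreal (F0 x) * indicator B x)
        + ennreal (1 / (4 * K)) * ennreal ((F1 x)\<^sup>2 / F0 x)"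
      by (auto split: split_indicator)
  qed
  also have "\<dots> = ennreal K * b + ennreal (1 / (4 * K)) * (\<integral>\<^sup>+x. ennreal ((F1 x)\<^sup>2 / F0 x) \<partial>M)"
    unfolding b_def by (simp add: nn_integral_add nn_integral_cmult emeasure_density)
  also have "\<dots> \<le> ennreal K * b + ennreal (1 / (4 * K)) * ennreal K"
    using K(2) by (intro add_mono mult_left_mono) auto
  also have "ennreal (1 / (4 * K)) * ennreal K = ennreal (1 / 4)"
    using K(1) by (simp flip: ennreal_mult)
  finally have le: "ennreal (1 / 2) \<le> ennreal K * b + ennreal (1 / 4)" .
  show ?thesis
  proof (cases b)
    case (real r)
    have "ennreal (1 / 2) \<le> ennreal (K * r + 1 / 4)"
      using le real K(1) by (simp add: ennreal_mult ennreal_plus)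
    hence "1 / 2 \<le> K * r + 1 / 4"
      using real K(1) by (subst (asm) ennreal_le_iff) auto
    hence "1 / (4 * K) \<le> r" using K(1) by (simp add: field_simps)
    thus ?thesis using real by (simp add: b_def[symmetric] ennreal_leI)
  next
    case top
    thus ?thesis by (simp add: b_def)
  qed
qed

lemma Lp_norm_markov:
  assumes [measurable]: "T \<in> borel_measurable M" and q: "1 \<le> q" and \<delta>: "0 \<le> \<delta>" and \<eta>: "0 \<le> \<eta>"
    and "ennreal \<eta> \<le> emeasure M {x \<in> space M. \<delta> \<le> \<bar>T x\<bar>}"
  shows "ennreal (\<delta> * \<eta> powr (1 / q)) \<le> Lp_norm (ennreal q) M T"
proof -
  define J where "J = (\<integral>\<^sup>+x. ennreal (\<bar>T x\<bar> powr q) \<partial>M)"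
  have "ennreal (\<delta> powr q) * ennreal \<eta> \<le> ennreal (\<delta> powr q) * emeasure M {x \<in> space M. \<delta> \<le> \<bar>T x\<bar>}"
    using assms(5) by (intro mult_left_mono) auto
  also have "\<dots> = (\<integral>\<^sup>+x. ennreal (\<delta> powr q) * indicator {x \<in> space M. \<delta> \<le> \<bar>T x\<bar>} x \<partial>M)"
    by (subst nn_integral_cmult_indicator) auto
  also have "\<dots> \<le> J"
    unfolding J_def using \<delta> q
    by (intro nn_integral_mono) (auto split: split_indicator intro!: ennreal_leI powr_mono2)
  finally have J: "ennreal (\<delta> powr q * \<eta>) \<le> J" using \<eta> by (simp add: ennreal_mult)
  show ?thesis
  proof (cases "J = \<infinity>")
    case True
    thus ?thesis using q unfolding Lp_norm_def by (simp add: J_def Let_def)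
  next
    case False
    then obtain j where j: "J = ennreal j" "0 \<le> j" by (cases J) auto
    have "\<delta> powr q * \<eta> \<le> j" using J j by simp
    hence "(\<delta> powr q * \<eta>) powr (1 / q) \<le> j powr (1 / q)"
      using q \<eta> by (intro powr_mono2) auto
    moreover have "(\<delta> powr q * \<eta>) powr (1 / q) = \<delta> * \<eta> powr (1 / q)"
      using q \<delta> \<eta> by (simp add: powr_mult powr_powr)
    ultimately show ?thesis
      using q j unfolding Lp_norm_def by (simp add: J_def[symmetric] Let_def ennreal_leI)
  qed
qed

text \<open>As \<open>2 * \<delta>\<close> is at most the gap, every value of \<open>T\<close> is at
  distance at least \<delta> from one of the parameters, so under \<open>F1\<close> one of the two
  error events has probability at least 1/2. If it is the error with respect to
  \<open>\<theta>0\<close>, it is carried over to \<open>F0\<close>; a transfer in the other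
  direction never occurs. \<open>1 \<le> K\<close> makes 1/(4K) a valid bound in both cases.\<close>

lemma two_point_risk:
  fixes F0 F1 :: "'a \<Rightarrow> real"
  assumes meas: "F0 \<in> borel_measurable M" "F1 \<in> borel_measurable M" "T \<in> borel_measurable M"
    and pos: "\<And>x. x \<in> space M \<Longrightarrow> 0 < F0 x" "\<And>x. x \<in> space M \<Longrightarrow> 0 \<le> F1 x"
    and one: "(\<integral>\<^sup>+x. ennreal (F1 x) \<partial>M) = 1"
    and K: "1 \<le> K" "(\<integral>\<^sup>+x. ennreal ((F1 x)\<^sup>2 / F0 x) \<partial>M) \<le> ennreal K"
    and q: "1 \<le> q" and \<delta>: "0 \<le> \<delta>" "2 * \<delta> \<le> \<theta>1 - \<theta>0"
  shows "ennreal (\<delta> * (1 / (4 * K)) powr (1 / q)) \<le>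
    max (Lp_norm (ennreal q) (density M (\<lambda>x. ennreal (F0 x))) (\<lambda>x. T x - \<theta>0))
        (Lp_norm (ennreal q) (density M (\<lambda>x. ennreal (F1 x))) (\<lambda>x. T x - \<theta>1))"
proof -
  note [measurable] = meas
  let ?P0 = "density M (\<lambda>x. ennreal (F0 x))" and ?P1 = "density M (\<lambda>x. ennreal (F1 x))"
  define B where "B = {x \<in> space M. \<delta> \<le> \<bar>T x - \<theta>0\<bar>}"
  have [measurable]: "B \<in> sets M" unfolding B_def by measurable
  show ?thesis
  proof (cases "ennreal (1 / 2) \<le> emeasure ?P1 B")
    case True
    have "ennreal (1 / (4 * K)) \<le> emeasure ?P0 B"
      using True K pos by (intro two_point_prob[where ?F1.0 = F1]) auto
    hence "ennreal (\<delta> * (1 / (4 * K)) powr (1 / q)) \<le> Lp_norm (ennreal q) ?P0 (\<lambda>x. T x - \<theta>0)"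
      using q \<delta>(1) K(1) by (intro Lp_norm_markov) (auto simp: B_def)
    thus ?thesis by (simp add: le_max_iff_disj)
  next
    case False
    define C where "C = {x \<in> space M. \<delta> \<le> \<bar>T x - \<theta>1\<bar>}"
    have [measurable]: "C \<in> sets M" unfolding C_def by measurable
    have "1 = emeasure ?P1 (space M)"
      using one by (simp add: emeasure_density)
    also have "\<dots> \<le> emeasure ?P1 (B \<union> C)"
      using \<delta> by (intro emeasure_mono) (auto simp: B_def C_def)
    also have "\<dots> \<le> emeasure ?P1 B + emeasure ?P1 C"
      by (intro emeasure_subadditive) auto
    finally have le: "1 \<le> emeasure ?P1 B + emeasure ?P1 C" .
    have "ennreal (1 / 2) \<le> emeasure ?P1 C"
    proof (rule ccontr)
      assume "\<not> ?thesis"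
      with False have "emeasure ?P1 B + emeasure ?P1 C < ennreal (1 / 2) + ennreal (1 / 2)"
        by (intro add_strict_mono) auto
      moreover have "ennreal (1 / 2) + ennreal (1 / 2) = 1" by (subst ennreal_plus[symmetric]) auto
      ultimately show False using le by simp
    qed
    moreover have "ennreal (1 / (4 * K)) \<le> ennreal (1 / 2)"
      using K(1) by (intro ennreal_leI) (simp add: field_simps)
    ultimately have "ennreal (\<delta> * (1 / (4 * K)) powr (1 / q)) \<le> Lp_norm (ennreal q) ?P1 (\<lambda>x. T x - \<theta>1)"
      using q \<delta>(1) K(1) by (intro Lp_norm_markov) (auto simp: C_def intro: order_trans)
    thus ?thesis by (simp add: le_max_iff_disj)
  qed
qed

section \<open>The law of n independent observations\<close>

lemma prob_space_density_nn:
  fixes f :: "'a \<Rightarrow> real"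
  assumes [measurable]: "f \<in> borel_measurable M" and "(\<integral>\<^sup>+x. ennreal (f x) \<partial>M) = 1"
  shows "prob_space (density M (\<lambda>x. ennreal (f x)))"
  using assms(2) by (intro prob_spaceI) (simp add: emeasure_density)

text \<open>Checked on rectangles. Having both sample laws as densities over one common product
  measure makes the likelihood ratio available.\<close>

lemma sample_law_density:
  assumes [measurable]: "f \<in> borel_measurable (leb {1..d})"
    and nonneg: "\<And>x. x \<in> space (leb {1..d}) \<Longrightarrow> 0 \<le> f x"
    and one: "(\<integral>\<^sup>+x. ennreal (f x) \<partial>leb {1..d}) = 1"
  shows "sample_law d n f
    = density (PiM {1..n} (\<lambda>_. leb {1..d})) (\<lambda>\<omega>. ennreal (\<Prod>k\<in>{1..n}. f (\<omega> k)))"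
proof -
  let ?N = "density (leb {1..d}) (\<lambda>x. ennreal (f x))"
  interpret leb_prod: product_sigma_finite "\<lambda>_::nat. leb {1..d}"
    by (simp add: product_sigma_finite_def leb_sigma_finite)
  interpret N: prob_space ?N
    by (rule prob_space_density_nn[OF assms(1) one])
  interpret prod: product_sigma_finite "\<lambda>_::nat. ?N"
    unfolding product_sigma_finite_def by (intro allI N.sigma_finite_measure_axioms)
  have "density (PiM {1..n} (\<lambda>_. leb {1..d})) (\<lambda>\<omega>. ennreal (\<Prod>k\<in>{1..n}. f (\<omega> k))) = PiM {1..n} (\<lambda>_. ?N)"
  proof (rule prod.PiM_eqI)
    show "sets (density (PiM {1..n} (\<lambda>_. leb {1..d})) (\<lambda>\<omega>. ennreal (\<Prod>k\<in>{1..n}. f (\<omega> k))))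
        = sets (PiM {1..n} (\<lambda>_. ?N))"
      by (simp cong: sets_PiM_cong)
    fix A :: "nat \<Rightarrow> (nat \<Rightarrow> real) set" assume A: "\<And>i. i \<in> {1..n} \<Longrightarrow> A i \<in> sets ?N"
    hence A': "A i \<in> sets (leb {1..d})" if "i \<in> {1..n}" for i using that by simp
    have [measurable]: "Pi\<^sub>E {1..n} A \<in> sets (PiM {1..n} (\<lambda>_. leb {1..d}))"
      using A' by (intro sets_PiM_I_finite) auto
    have "emeasure (density (PiM {1..n} (\<lambda>_. leb {1..d})) (\<lambda>\<omega>. ennreal (\<Prod>k\<in>{1..n}. f (\<omega> k)))) (Pi\<^sub>E {1..n} A)
        = (\<integral>\<^sup>+\<omega>. ennreal (\<Prod>k\<in>{1..n}. f (\<omega> k)) * indicator (Pi\<^sub>E {1..n} A) \<omega> \<partial>PiM {1..n} (\<lambda>_. leb {1..d}))"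
      by (rule emeasure_density) measurable
    also have "\<dots> = (\<integral>\<^sup>+\<omega>. (\<Prod>k\<in>{1..n}. ennreal (f (\<omega> k)) * indicator (A k) (\<omega> k)) \<partial>PiM {1..n} (\<lambda>_. leb {1..d}))"
    proof (rule nn_integral_cong)
      fix \<omega> assume \<omega>: "\<omega> \<in> space (PiM {1..n} (\<lambda>_. leb {1..d}))"
      have "ennreal (\<Prod>k\<in>{1..n}. f (\<omega> k)) = (\<Prod>k\<in>{1..n}. ennreal (f (\<omega> k)))"
        using \<omega> by (intro prod_ennreal[symmetric] nonneg) (auto simp: space_PiM PiE_iff)
      moreover have "indicator (Pi\<^sub>E {1..n} A) \<omega> = (\<Prod>k\<in>{1..n}. indicator (A k) (\<omega> k) :: ennreal)"
        using \<omega> by (auto simp: indicator_def space_PiM PiE_iff prod_zero_iff)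
      ultimately show "ennreal (\<Prod>k\<in>{1..n}. f (\<omega> k)) * indicator (Pi\<^sub>E {1..n} A) \<omega>
          = (\<Prod>k\<in>{1..n}. ennreal (f (\<omega> k)) * indicator (A k) (\<omega> k))"
        by (simp add: prod.distrib)
    qed
    also have "\<dots> = (\<Prod>k\<in>{1..n}. \<integral>\<^sup>+x. ennreal (f x) * indicator (A k) x \<partial>leb {1..d})"
    proof (rule leb_prod.product_nn_integral_prod)
      fix k assume "k \<in> {1..n}"
      note [measurable] = A'[OF this]
      show "(\<lambda>x. ennreal (f x) * indicator (A k) x) \<in> borel_measurable (leb {1..d})" by measurable
    qed simp
    also have "\<dots> = (\<Prod>k\<in>{1..n}. emeasure ?N (A k))"
    proof (intro prod.cong refl emeasure_density[symmetric])
      show "(\<lambda>x. ennreal (f x)) \<in> borel_measurable (leb {1..d})" by measurable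
    qed (rule A')
    finally show "emeasure (density (PiM {1..n} (\<lambda>_. leb {1..d})) (\<lambda>\<omega>. ennreal (\<Prod>k\<in>{1..n}. f (\<omega> k)))) (Pi\<^sub>E {1..n} A)
        = (\<Prod>k\<in>{1..n}. emeasure ?N (A k))" .
  qed simp
  thus ?thesis by (simp add: sample_law_def)
qed

text \<open>The second moment of the likelihood ratio is multiplicative over independent
  observations, so an excess of \<open>\<kappa> / n\<close> per observation accumulates to at most
  \<open>(1 + \<kappa> / n)^n \<le> exp \<kappa>\<close>.\<close>

lemma two_density_risk:
  assumes f0: "f0 \<in> borel_measurable (leb {1..d})" "\<And>x. x \<in> space (leb {1..d}) \<Longrightarrow> 0 < f0 x"
      "(\<integral>\<^sup>+x. ennreal (f0 x) \<partial>leb {1..d}) = 1"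
    and f1: "is_density {1..d} f1"
    and \<chi>: "0 \<le> \<kappa>" "(\<integral>\<^sup>+x. ennreal ((f1 x)\<^sup>2 / f0 x) \<partial>leb {1..d}) \<le> ennreal (1 + \<kappa> / real n)"
    and n: "1 \<le> n" and q: "1 \<le> q" and \<delta>: "0 \<le> \<delta>" "2 * \<delta> \<le> f1 x0 - f0 x0"
    and x0: "x0 \<in> space (leb {1..d})" and T: "T \<in> estimators d n" and \<Sigma>: "f0 \<in> \<Sigma>" "f1 \<in> \<Sigma>"
  shows "ennreal (\<delta> * (1 / (4 * exp \<kappa>)) powr (1 / q)) \<le> risk q d n x0 T \<Sigma>"
proof -
  have f1': "f1 \<in> borel_measurable (leb {1..d})" "\<And>x. x \<in> space (leb {1..d}) \<Longrightarrow> 0 \<le> f1 x"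
      "(\<integral>\<^sup>+x. ennreal (f1 x) \<partial>leb {1..d}) = 1"
    using f1 by (auto simp: is_density_def)
  note [measurable] = f0(1) f1'(1)
  interpret leb_prod: product_sigma_finite "\<lambda>_::nat. leb {1..d}"
    by (simp add: product_sigma_finite_def leb_sigma_finite)
  let ?M = "PiM {1..n} (\<lambda>_. leb {1..d})"
  define F0 where "F0 \<omega> = (\<Prod>k\<in>{1..n}. f0 (\<omega> k))" for \<omega> :: "nat \<Rightarrow> nat \<Rightarrow> real"
  define F1 where "F1 \<omega> = (\<Prod>k\<in>{1..n}. f1 (\<omega> k))" for \<omega> :: "nat \<Rightarrow> nat \<Rightarrow> real"
  have comp: "\<omega> k \<in> space (leb {1..d})" if "\<omega> \<in> space ?M" "k \<in> {1..n}" for \<omega> k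
    using that by (auto simp: space_PiM PiE_iff)
  have "(\<integral>\<^sup>+\<omega>. ennreal (F1 \<omega>) \<partial>?M) = (\<integral>\<^sup>+\<omega>. (\<Prod>k\<in>{1..n}. ennreal (f1 (\<omega> k))) \<partial>?M)"
    unfolding F1_def using comp by (intro nn_integral_cong prod_ennreal[symmetric] f1'(2)) auto
  also have "\<dots> = 1" 
    by (subst leb_prod.product_nn_integral_prod[of "{1..n}" "\<lambda>_ x. ennreal (f1 x)"])
      (auto simp only: f1'(3) prod.neutral_const finite_atLeastAtMost, measurable)
  finally have one: "(\<integral>\<^sup>+\<omega>. ennreal (F1 \<omega>) \<partial>?M) = 1" .
  have "(\<integral>\<^sup>+\<omega>. ennreal ((F1 \<omega>)\<^sup>2 / F0 \<omega>) \<partial>?M)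
      = (\<integral>\<^sup>+\<omega>. (\<Prod>k\<in>{1..n}. ennreal ((f1 (\<omega> k))\<^sup>2 / f0 (\<omega> k))) \<partial>?M)"
  proof (rule nn_integral_cong)
    fix \<omega> assume \<omega>: "\<omega> \<in> space ?M"
    have "(F1 \<omega>)\<^sup>2 / F0 \<omega> = (\<Prod>k\<in>{1..n}. (f1 (\<omega> k))\<^sup>2 / f0 (\<omega> k))"
      unfolding F1_def F0_def by (simp add: prod_power_distrib prod_dividef)
    also have "ennreal \<dots> = (\<Prod>k\<in>{1..n}. ennreal ((f1 (\<omega> k))\<^sup>2 / f0 (\<omega> k)))"
      using comp[OF \<omega>] f0(2)
      by (intro prod_ennreal[symmetric] divide_nonneg_nonneg) (auto intro: less_imp_le)
    finally show "ennreal ((F1 \<omega>)\<^sup>2 / F0 \<omega>) = (\<Prod>k\<in>{1..n}. ennreal ((f1 (\<omega> k))\<^sup>2 / f0 (\<omega> k)))" .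
  qed
  also have "\<dots> = (\<integral>\<^sup>+x. ennreal ((f1 x)\<^sup>2 / f0 x) \<partial>leb {1..d}) ^ n"
    using leb_prod.product_nn_integral_prod[of "{1..n}" "\<lambda>_ x. ennreal ((f1 x)\<^sup>2 / f0 x)"]
    by (simp del: One_nat_def)
  also have "\<dots> \<le> ennreal (1 + \<kappa> / real n) ^ n"
    using \<chi>(2) by (intro power_mono) auto
  also have "\<dots> = ennreal ((1 + \<kappa> / real n) ^ n)"
    using \<chi>(1) by (intro ennreal_power) auto
  also have "\<dots> \<le> ennreal (exp \<kappa>)"
    using exp_ge_one_plus_x_over_n_power_n[of n \<kappa>] \<chi>(1) n by (intro ennreal_leI) auto
  finally have K: "(\<integral>\<^sup>+\<omega>. ennreal ((F1 \<omega>)\<^sup>2 / F0 \<omega>) \<partial>?M) \<le> ennreal (exp \<kappa>)" .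
  have T': "(\<lambda>\<omega>. T \<omega> x0) \<in> borel_measurable ?M"
    using T x0 by (auto simp: estimators_def)
  have "ennreal (\<delta> * (1 / (4 * exp \<kappa>)) powr (1 / q)) \<le>
    max (Lp_norm (ennreal q) (density ?M (\<lambda>x. ennreal (F0 x))) (\<lambda>\<omega>. T \<omega> x0 - f0 x0))
        (Lp_norm (ennreal q) (density ?M (\<lambda>x. ennreal (F1 x))) (\<lambda>\<omega>. T \<omega> x0 - f1 x0))"
  proof (rule two_point_risk)
    show "F0 \<in> borel_measurable ?M" "F1 \<in> borel_measurable ?M" unfolding F0_def F1_def by measurable
    show "0 < F0 \<omega>" "0 \<le> F1 \<omega>" if "\<omega> \<in> space ?M" for \<omega>
      unfolding F0_def F1_def using comp[OF that] f0(2) f1'(2) by (auto intro!: prod_pos prod_nonneg)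
  qed (use one K q \<delta> \<chi>(1) T' in \<open>auto simp del: One_nat_def\<close>)
  also have "\<dots> = max (Lp_norm (ennreal q) (sample_law d n f0) (\<lambda>\<omega>. T \<omega> x0 - f0 x0))
        (Lp_norm (ennreal q) (sample_law d n f1) (\<lambda>\<omega>. T \<omega> x0 - f1 x0))"
  proof -
    have "sample_law d n f1 = density ?M (\<lambda>x. ennreal (F1 x))"
      unfolding F1_def by (rule sample_law_density) (fact f1')+
    moreover have "sample_law d n f0 = density ?M (\<lambda>x. ennreal (F0 x))"
      unfolding F0_def by (rule sample_law_density[OF f0(1) less_imp_le f0(3)]) (rule f0(2))
    ultimately show ?thesis by simp
  qed
  also have "\<dots> \<le> risk q d n x0 T \<Sigma>"
    unfolding risk_def using \<Sigma> by (auto intro!: SUP_upper)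
  finally show ?thesis .
qed

section \<open>Perturbed product densities\<close>

text \<open>Tonelli's theorem. The Bochner integral in \<open>marginal\<close> agrees with the inner
  Tonelli integral only where the latter is finite, which is almost everywhere because the total
  mass is 1.\<close>

lemma marginal_norm_eq_1:
  assumes S: "finite S" "J \<subseteq> S" and f: "is_density S f"
  shows "Lp_norm 1 (leb J) (marginal S J f) = 1"
proof -
  have [measurable]: "f \<in> borel_measurable (leb S)" using f by (simp add: is_density_def)
  have fin: "finite J" "finite (S - J)" and un: "J \<union> (S - J) = S" and dis: "J \<inter> (S - J) = {}"
    using S finite_subset by auto
  interpret SJ: sigma_finite_measure "leb (S - J)" by (rule leb_sigma_finite[OF fin(2)])
  define G where "G y = (\<integral>\<^sup>+z. ennreal (f (merge J (S - J) (y, z))) \<partial>leb (S - J))" for y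
  have mm: "(\<lambda>yz. f (merge J (S - J) yz)) \<in> borel_measurable (leb J \<Otimes>\<^sub>M leb (S - J))"
  proof -
    have "merge J (S - J) \<in> leb J \<Otimes>\<^sub>M leb (S - J) \<rightarrow>\<^sub>M leb S"
      using measurable_merge[of J "S - J" "\<lambda>_. lborel :: real measure"] by (simp only: un)
    thus ?thesis by (rule measurable_compose) measurable
  qed
  have [measurable]: "G \<in> borel_measurable (leb J)"
    unfolding G_def using mm by (intro SJ.borel_measurable_nn_integral) (simp add: case_prod_unfold)
  have "(\<integral>\<^sup>+x. ennreal (f x) \<partial>leb S) = (\<integral>\<^sup>+y. G y \<partial>leb J)"
    unfolding G_def
    by (rule lborel_product.product_nn_integral_fold[OF dis fin, unfolded un]) measurable
  hence one: "(\<integral>\<^sup>+y. G y \<partial>leb J) = 1" using f by (simp add: is_density_def)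
  hence "AE y in leb J. G y \<noteq> \<infinity>" by (intro nn_integral_PInf_AE) auto
  hence "AE y in leb J. ennreal (\<bar>marginal S J f y\<bar> powr 1) = G y"
    using AE_space
  proof eventually_elim
    case (elim y)
    have "merge J (S - J) (y, z) \<in> space (leb S)" if "z \<in> space (leb (S - J))" for z
      using S that elim(2) by (auto simp: space_PiM merge_def PiE_iff extensional_def)
    hence "AE z in leb (S - J). 0 \<le> f (merge J (S - J) (y, z))"
      using f by (intro AE_I2) (auto simp: is_density_def)
    moreover have "(\<lambda>z. f (merge J (S - J) (y, z))) \<in> borel_measurable (leb (S - J))"
      using measurable_compose[OF measurable_Pair1'[OF elim(2)] mm] by simp
    ultimately have "marginal S J f y = enn2real (G y)"
      unfolding marginal_def G_def by (intro integral_eq_nn_integral) auto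
    thus ?case using elim(1) by (simp add: less_top[symmetric])
  qed
  hence "(\<integral>\<^sup>+y. ennreal (\<bar>marginal S J f y\<bar> powr 1) \<partial>leb J) = 1"
    using one nn_integral_cong_AE by metis
  thus ?thesis unfolding Lp_norm_def by simp
qed

text \<open>Null (\<open>A = 0\<close>) and alternative share this shape, and integrating out
  coordinates preserves it, so everything reduces to one-dimensional integrals of \<open>w\<close>
  and \<open>v\<close>.\<close>

definition two_prod ::
  "nat set \<Rightarrow> real \<Rightarrow> (nat \<Rightarrow> real \<Rightarrow> real) \<Rightarrow> (nat \<Rightarrow> real \<Rightarrow> real) \<Rightarrow> (nat \<Rightarrow> real) \<Rightarrow> real"
  where "two_prod S A w v x = (\<Prod>i\<in>S. w i (x i)) + A * (\<Prod>i\<in>S. v i (x i))"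

lemma two_prod_integral:
  assumes "finite S" "\<And>i. i \<in> S \<Longrightarrow> integrable lborel (w i)" "\<And>i. i \<in> S \<Longrightarrow> integrable lborel (v i)"
  shows "integrable (leb S) (two_prod S A w v)"
    and "(\<integral>x. two_prod S A w v x \<partial>leb S)
      = (\<Prod>i\<in>S. \<integral>y. w i y \<partial>lborel) + A * (\<Prod>i\<in>S. \<integral>y. v i y \<partial>lborel)"
proof -
  note int = lborel_product.product_integrable_prod[OF assms(1)]
  show "integrable (leb S) (two_prod S A w v)"
    unfolding two_prod_def[abs_def] using assms by (intro Bochner_Integration.integrable_add integrable_mult_right int) auto
  have "(\<integral>x. two_prod S A w v x \<partial>leb S)
      = (\<integral>x. (\<Prod>i\<in>S. w i (x i)) \<partial>leb S) + A * (\<integral>x. (\<Prod>i\<in>S. v i (x i)) \<partial>leb S)"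
    unfolding two_prod_def using assms
    by (subst Bochner_Integration.integral_add) (auto intro!: int)
  thus "(\<integral>x. two_prod S A w v x \<partial>leb S)
      = (\<Prod>i\<in>S. \<integral>y. w i y \<partial>lborel) + A * (\<Prod>i\<in>S. \<integral>y. v i y \<partial>lborel)"
    using assms by (simp add: lborel_product.product_integral_prod)
qed

lemma marginal_two_prod:
  assumes S: "finite S" "J \<subseteq> S"
    and int: "\<And>i. i \<in> S \<Longrightarrow> integrable lborel (w i)" "\<And>i. i \<in> S \<Longrightarrow> integrable lborel (v i)"
  shows "marginal S J (two_prod S A w v) y
    = (\<Prod>i\<in>J. w i (y i)) * (\<Prod>i\<in>S - J. \<integral>t. w i t \<partial>lborel)
      + A * ((\<Prod>i\<in>J. v i (y i)) * (\<Prod>i\<in>S - J. \<integral>t. v i t \<partial>lborel))"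
proof -
  define W where "W = (\<Prod>i\<in>J. w i (y i))"
  define V where "V = (\<Prod>i\<in>J. v i (y i))"
  have split: "(\<Prod>i\<in>S. u i (merge J (S - J) (y, z) i)) = (\<Prod>i\<in>J. u i (y i)) * (\<Prod>i\<in>S - J. u i (z i))"
    for u :: "nat \<Rightarrow> real \<Rightarrow> real" and z
  proof -
    have "(\<Prod>i\<in>S. u i (merge J (S - J) (y, z) i))
      = (\<Prod>i\<in>S - J. u i (merge J (S - J) (y, z) i)) * (\<Prod>i\<in>J. u i (merge J (S - J) (y, z) i))"
      using S by (rule prod.subset_diff[rotated])
    moreover have "(\<Prod>i\<in>J. u i (merge J (S - J) (y, z) i)) = (\<Prod>i\<in>J. u i (y i))"
      by (intro prod.cong) (auto simp: merge_def)
    moreover have "(\<Prod>i\<in>S - J. u i (merge J (S - J) (y, z) i)) = (\<Prod>i\<in>S - J. u i (z i))"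
      by (intro prod.cong) (auto simp: merge_def)
    ultimately show ?thesis by simp
  qed
  note int' = lborel_product.product_integrable_prod[of "S - J"]
    and eq' = lborel_product.product_integral_prod[of "S - J"]
  have "marginal S J (two_prod S A w v) y
      = (\<integral>z. W * (\<Prod>i\<in>S - J. w i (z i)) + A * (V * (\<Prod>i\<in>S - J. v i (z i))) \<partial>leb (S - J))"
    unfolding marginal_def two_prod_def split W_def V_def ..
  also have "\<dots> = W * (\<integral>z. (\<Prod>i\<in>S - J. w i (z i)) \<partial>leb (S - J))
      + A * (V * (\<integral>z. (\<Prod>i\<in>S - J. v i (z i)) \<partial>leb (S - J)))"
    using S int by (subst Bochner_Integration.integral_add) (auto intro!: int' integrable_mult_right)
  also have "\<dots> = W * (\<Prod>i\<in>S - J. \<integral>t. w i t \<partial>lborel) + A * (V * (\<Prod>i\<in>S - J. \<integral>t. v i t \<partial>lborel))"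
    using S int by (subst (1 2) eq') auto
  finally show ?thesis unfolding W_def V_def .
qed

text \<open>\<open>v\<close> carries the spike profile inside the block \<open>I\<close> and repeats
  the null factor outside. The first makes the spike vanish once a coordinate of \<open>I\<close> is
  integrated out, the second keeps the factorisation over the blocks.\<close>

locale perturbed_product =
  fixes S :: "nat set" and P :: "nat set set" and I :: "nat set" and w v :: "nat \<Rightarrow> real \<Rightarrow> real"
  assumes S: "finite S" and P: "partition_on S P" and I: "I \<in> P"
    and integrable: "\<And>i. i \<in> S \<Longrightarrow> integrable lborel (w i)" "\<And>i. i \<in> S \<Longrightarrow> integrable lborel (v i)"
    and w_integral: "\<And>i. i \<in> S \<Longrightarrow> (\<integral>t. w i t \<partial>lborel) = 1"
    and v_integral: "\<And>i. i \<in> I \<Longrightarrow> (\<integral>t. v i t \<partial>lborel) = 0"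
    and v_eq: "\<And>i. i \<notin> I \<Longrightarrow> v i = w i"
    and w_pos: "\<And>i t. 0 < w i t"
begin

lemma blocks: "J \<in> P \<Longrightarrow> J \<subseteq> S" "J \<in> P \<Longrightarrow> finite J" "J \<in> P \<Longrightarrow> J \<noteq> {}"
  "J \<in> P \<Longrightarrow> J \<noteq> I \<Longrightarrow> J \<inter> I = {}"
proof -
  show "J \<in> P \<Longrightarrow> J \<subseteq> S" using P by (auto simp: partition_on_def)
  thus "J \<in> P \<Longrightarrow> finite J" using S by (rule finite_subset)
qed (use P I in \<open>auto simp: partition_on_def disjoint_def\<close>)

lemma v_prod_integral: "(\<Prod>i\<in>S. \<integral>t. v i t \<partial>lborel) = 0"
  using blocks[OF I] v_integral S by (subst prod_zero_iff) auto

text \<open>For \<open>J \<noteq> I\<close> all of \<open>I\<close> is integrated out, which kills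
  the spike. For \<open>J = I\<close> only null factors of mass 1 are integrated out, which leaves
  its height unchanged.\<close>

lemma marginal_eq:
  assumes J: "J \<in> P"
  shows "marginal S J (two_prod S A w v) = two_prod J (if J = I then A else 0) w v"
proof
  fix y
  have 1: "(\<Prod>i\<in>S - J. \<integral>t. w i t \<partial>lborel) = 1" using w_integral by (intro prod.neutral) auto
  have 2: "(\<Prod>i\<in>S - J. \<integral>t. v i t \<partial>lborel) = (if J = I then 1 else 0)"
  proof (cases "J = I")
    case True
    thus ?thesis using w_integral v_eq by (auto intro!: prod.neutral)
  next
    case False
    hence "I \<subseteq> S - J" using blocks[OF I] blocks(4)[OF J] by auto
    thus ?thesis using False blocks(3)[OF I] v_integral S by (auto simp: prod_zero_iff)
  qed
  show "marginal S J (two_prod S A w v) y = two_prod J (if J = I then A else 0) w v y"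
    using S blocks(1)[OF J] integrable
    by (subst marginal_two_prod) (auto simp: 1 2 two_prod_def)
qed

text \<open>Null and spike have the product of \<open>w\<close> over the other blocks as a common
  factor; what remains after taking it out is the marginal on \<open>I\<close>.\<close>

lemma product_formula:
  "two_prod S A w v x = (\<Prod>J\<in>P. marginal S J (two_prod S A w v) (restrict x J))"
proof -
  have finP: "finite P" using P S by (metis finite_elements)
  have prod_S: "(\<Prod>i\<in>S. u i (x i)) = (\<Prod>i\<in>I. u i (x i)) * (\<Prod>J\<in>P - {I}. \<Prod>i\<in>J. u i (x i))"
    for u :: "nat \<Rightarrow> real \<Rightarrow> real"
  proof -
    have "(\<Prod>i\<in>S. u i (x i)) = (\<Prod>J\<in>P. \<Prod>i\<in>J. u i (x i))"
      using P blocks(2) unfolding partition_on_def disjoint_def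
      by (metis (no_types, lifting) prod.Union_disjoint comp_apply prod.cong)
    thus ?thesis using prod.remove[OF finP I] by simp
  qed
  have restr: "two_prod J B w v (restrict x J) = two_prod J B w v x" for J B
    unfolding two_prod_def by simp
  have "(\<Prod>J\<in>P. marginal S J (two_prod S A w v) (restrict x J))
      = (\<Prod>J\<in>P. two_prod J (if J = I then A else 0) w v x)"
    by (intro prod.cong refl) (simp add: marginal_eq restr)
  also have "\<dots> = two_prod I A w v x * (\<Prod>J\<in>P - {I}. \<Prod>i\<in>J. w i (x i))"
    unfolding prod.remove[OF finP I] by (simp add: two_prod_def)
  also have "\<dots> = two_prod S A w v x"
  proof -
    have "(\<Prod>J\<in>P - {I}. \<Prod>i\<in>J. v i (x i)) = (\<Prod>J\<in>P - {I}. \<Prod>i\<in>J. w i (x i))"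
      using blocks(4) v_eq by (intro prod.cong refl) (metis Diff_iff disjoint_iff singletonI)
    thus ?thesis by (simp add: two_prod_def prod_S distrib_right)
  qed
  finally show ?thesis ..
qed

lemma is_density_two_prod:
  assumes "\<And>x. 0 \<le> two_prod S A w v x"
  shows "is_density S (two_prod S A w v)"
proof -
  note int = two_prod_integral[OF S integrable, where A = A]
  have "(\<integral>x. two_prod S A w v x \<partial>leb S) = 1"
    using int(2) v_prod_integral w_integral by simp
  thus ?thesis
    unfolding is_density_def using assms int(1)
    by (auto simp: nn_integral_eq_integral)
qed

text \<open>With W and V the two products, \<open>(W + A V)^2 / W = W + 2 A V + A^2 V^2 / W\<close>.
  The first term has mass 1, the second mass 0, and the third factorises; outside \<open>I\<close>
  its factors are \<open>w\<close> again and have mass 1.\<close>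

lemma chi_square_bound:
  assumes A: "0 \<le> A" and int: "\<And>i. i \<in> I \<Longrightarrow> integrable lborel (\<lambda>t. (v i t)\<^sup>2 / w i t)"
    and B: "\<And>i. i \<in> I \<Longrightarrow> (\<integral>t. (v i t)\<^sup>2 / w i t \<partial>lborel) \<le> B i"
  shows "(\<integral>\<^sup>+x. ennreal ((two_prod S A w v x)\<^sup>2 / two_prod S 0 w v x) \<partial>leb S)
    \<le> ennreal (1 + A\<^sup>2 * (\<Prod>i\<in>I. B i))"
proof -
  define u where "u i t = (v i t)\<^sup>2 / w i t" for i t
  have u_eq: "u i = w i" if "i \<notin> I" for i
    using v_eq[OF that] w_pos[of i] by (auto simp: u_def fun_eq_iff power2_eq_square less_imp_neq[symmetric])
  have u_int: "integrable lborel (u i)" if "i \<in> S" for i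
    using int[of i] integrable(1)[OF that] u_eq[of i] by (cases "i \<in> I") (auto simp: u_def[abs_def])
  have eq: "(two_prod S A w v x)\<^sup>2 / two_prod S 0 w v x
      = two_prod S (2 * A) w v x + A\<^sup>2 * (\<Prod>i\<in>S. u i (x i))" for x
  proof -
    have W: "0 < (\<Prod>i\<in>S. w i (x i))" by (intro prod_pos) (simp add: w_pos)
    have "(\<Prod>i\<in>S. u i (x i)) = (\<Prod>i\<in>S. v i (x i))\<^sup>2 / (\<Prod>i\<in>S. w i (x i))"
      by (simp add: u_def prod_dividef prod_power_distrib)
    thus ?thesis using W by (simp add: two_prod_def field_simps power2_eq_square)
  qed
  have uS: "integrable (leb S) (\<lambda>x. \<Prod>i\<in>S. u i (x i))"
    using S u_int by (intro lborel_product.product_integrable_prod) auto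
  have "(\<integral>\<^sup>+x. ennreal ((two_prod S A w v x)\<^sup>2 / two_prod S 0 w v x) \<partial>leb S)
      = ennreal (\<integral>x. (two_prod S A w v x)\<^sup>2 / two_prod S 0 w v x \<partial>leb S)"
  proof (rule nn_integral_eq_integral)
    show "integrable (leb S) (\<lambda>x. (two_prod S A w v x)\<^sup>2 / two_prod S 0 w v x)"
      unfolding eq using two_prod_integral(1)[OF S integrable] uS by auto
    show "AE x in leb S. 0 \<le> (two_prod S A w v x)\<^sup>2 / two_prod S 0 w v x"
      using w_pos by (intro AE_I2) (simp add: two_prod_def prod_nonneg less_imp_le)
  qed
  also have "(\<integral>x. (two_prod S A w v x)\<^sup>2 / two_prod S 0 w v x \<partial>leb S)
      = 1 + A\<^sup>2 * (\<integral>x. (\<Prod>i\<in>S. u i (x i)) \<partial>leb S)"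
    unfolding eq using two_prod_integral[OF S integrable, where A = "2 * A"] uS v_prod_integral w_integral
    by (subst Bochner_Integration.integral_add) auto
  also have "(\<integral>x. (\<Prod>i\<in>S. u i (x i)) \<partial>leb S) = (\<Prod>i\<in>S. \<integral>t. u i t \<partial>lborel)"
    using S u_int by (intro lborel_product.product_integral_prod) auto
  also have "\<dots> = (\<Prod>i\<in>I. \<integral>t. u i t \<partial>lborel)"
    using S blocks(1)[OF I] u_eq w_integral by (intro prod.mono_neutral_right) auto
  also have "ennreal (1 + A\<^sup>2 * \<dots>) \<le> ennreal (1 + A\<^sup>2 * (\<Prod>i\<in>I. B i))"
    using B w_pos by (intro ennreal_leI add_left_mono mult_left_mono prod_mono)
      (auto simp: u_def intro!: Bochner_Integration.integral_nonneg divide_nonneg_pos)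
  finally show ?thesis .
qed

end

section \<open>Choosing the scales: domination by the null, bandwidths, wide Gaussians\<close>

lemma gauss_poly_1_pos: "0 < gauss_poly 1 x"
  by (simp add: gauss_poly_def normal_density_pos)

lemma gauss_poly_1_eq: "gauss_poly 1 x = exp (- (x\<^sup>2) / 2) / sqrt (2 * pi)"
  by (simp add: gauss_poly_def std_normal_density_def)

text \<open>\<open>2 \<le> H\<close> is what makes the null Gaussian, of exponent
  \<open>y^2 / (2 * H^2)\<close>, decay no faster than the envelope already at bandwidth 1. In the
  squared form one envelope is traded for the null and the other is kept for integration.\<close>

lemma envelope_le_wide_gauss:
  assumes H: "2 \<le> H" and h: "0 < h" "h \<le> 1"
  shows "envelope (y / h) \<le> sqrt (2 * pi) * gauss_poly 1 (y / H)"
    and "(envelope (y / h))\<^sup>2 \<le> sqrt (2 * pi) * gauss_poly 1 (y / H) * envelope (y / h)"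
proof -
  have "y\<^sup>2 * (4 * h\<^sup>2) \<le> y\<^sup>2 * H\<^sup>2"
  proof (rule mult_left_mono)
    have "h\<^sup>2 \<le> 1" using h by (simp add: power_le_one)
    moreover have "2\<^sup>2 \<le> H\<^sup>2" using H by (intro power_mono) auto
    ultimately show "4 * h\<^sup>2 \<le> H\<^sup>2" by simp
  qed simp
  hence "(y / H)\<^sup>2 / 2 \<le> (y / h)\<^sup>2 / 8"
    using H h by (simp add: power_divide field_simps)
  thus 1: "envelope (y / h) \<le> sqrt (2 * pi) * gauss_poly 1 (y / H)"
    by (simp add: envelope_def gauss_poly_1_eq)
  show "(envelope (y / h))\<^sup>2 \<le> sqrt (2 * pi) * gauss_poly 1 (y / H) * envelope (y / h)"
    unfolding power2_eq_square using envelope_pos[of "y / h"] by (intro mult_right_mono 1) auto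
qed

text \<open>One of the two envelopes cancels the null in the denominator; the other, integrated at
  scale \<open>h\<close>, supplies the factor \<open>h\<close>.\<close>

lemma wave_chi_square:
  fixes a h H C :: real
  assumes C: "\<And>x. \<bar>gauss_poly wave x\<bar> \<le> C * envelope x"
    and H: "2 \<le> H" and h: "0 < h" "h \<le> 1"
  defines "u \<equiv> \<lambda>t. (gauss_poly wave ((t - a) / h))\<^sup>2 / (gauss_poly 1 ((t - a) / H) / H)"
  shows "integrable lborel u"
    and "(\<integral>t. u t \<partial>lborel) \<le> C\<^sup>2 * H * sqrt (2 * pi) * envelope_mass * h"
proof -
  define B where "B = C\<^sup>2 * H * sqrt (2 * pi)"
  have le: "u t \<le> B * envelope ((t - a) / h)" for t
  proof -
    have "(gauss_poly wave ((t - a) / h))\<^sup>2 \<le> (C * envelope ((t - a) / h))\<^sup>2"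
      using C[of "(t - a) / h"] by (metis abs_ge_zero power2_abs power_mono)
    also have "\<dots> \<le> C\<^sup>2 * (sqrt (2 * pi) * gauss_poly 1 ((t - a) / H) * envelope ((t - a) / h))"
      unfolding power_mult_distrib by (intro mult_left_mono envelope_le_wide_gauss H h) auto
    finally show ?thesis
      using H gauss_poly_1_pos[of "(t - a) / H"] by (simp add: u_def B_def field_simps)
  qed
  have nonneg: "0 \<le> u t" for t
    unfolding u_def using H gauss_poly_1_pos by (auto intro!: divide_nonneg_pos divide_pos_pos)
  have [measurable]: "u \<in> borel_measurable lborel" unfolding u_def by measurable
  have int: "integrable lborel (\<lambda>t. B * envelope ((t - a) / h))"
    using integral_rescale(1)[OF envelope_has_integral(1) h(1)] by simp
  show "integrable lborel u"
    by (rule Bochner_Integration.integrable_bound[OF int])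
      (auto simp: nonneg intro!: order_trans[OF le])
  hence "(\<integral>t. u t \<partial>lborel) \<le> (\<integral>t. B * envelope ((t - a) / h) \<partial>lborel)"
    using int le by (intro integral_mono) auto
  also have "\<dots> = B * envelope_mass * h"
    using integral_rescale(2)[OF envelope_has_integral(1) h(1)] by (simp add: envelope_mass_def)
  finally show "(\<integral>t. u t \<partial>lborel) \<le> C\<^sup>2 * H * sqrt (2 * pi) * envelope_mass * h"
    by (simp add: B_def)
qed

text \<open>The bandwidth exponents balance the smoothness constraint against the \<open>\<chi>\<^sup>2\<close> budget
  \<open>1 / n\<close>; for \<open>r \<le> 0\<close> the \<open>L\<^sub>p\<close> constraints tolerate spikes of constant height.\<close>
lemma bandwidth_exponents:
  fixes \<beta> \<kappa> :: "nat \<Rightarrow> real"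
  assumes I: "finite I" "I \<noteq> {}" and \<beta>: "\<And>i. i \<in> I \<Longrightarrow> 0 < \<beta> i" and \<kappa>: "\<And>i. i \<in> I \<Longrightarrow> 0 \<le> \<kappa> i"
  defines "r \<equiv> (1 - (\<Sum>i\<in>I. \<kappa> i / \<beta> i)) / (\<Sum>i\<in>I. 1 / \<beta> i)"
  defines "b \<equiv> if 0 < r then r / (2 * r + 1) else 0"
  shows "\<exists>a. (\<forall>i\<in>I. 0 \<le> a i \<and> a i * \<beta> i \<le> b + \<kappa> i * (\<Sum>j\<in>I. a j)) \<and> 1 \<le> 2 * b + (\<Sum>j\<in>I. a j)"
proof -
  define T where "T = (\<Sum>i\<in>I. 1 / \<beta> i)"
  define K where "K = (\<Sum>i\<in>I. \<kappa> i / \<beta> i)"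
  have T: "0 < T" unfolding T_def using I \<beta> by (intro sum_pos) auto
  have r: "r * T = 1 - K" unfolding r_def T_def[symmetric] K_def using T by simp
  show ?thesis
  proof (cases "0 < r")
    case True
    \<comment> \<open>All constraints are solved with equality. Summing
      \<open>a i = (b + v * \<kappa> i) / \<beta> i\<close> to \<open>v\<close> requires
      \<open>v * (1 - K) = b * T\<close>, that is \<open>b = r * v\<close>, and
      \<open>2 * b + v = 1\<close> then determines \<open>v\<close>.\<close>
    define v where "v = 1 / (2 * r + 1)"
    have v: "0 < v" "b = r * v" "2 * b + v = 1"
      using True by (auto simp: v_def b_def field_simps)
    define a where "a i = (b + v * \<kappa> i) / \<beta> i" for i
    have "(\<Sum>i\<in>I. a i) = b * T + v * K"
      by (simp add: a_def add_divide_distrib sum.distrib T_def K_def sum_distrib_left)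
    also have "\<dots> = v" using r by (simp add: v(2)) (metis (no_types, opaque_lifting)
          add.commute diff_add_cancel distrib_left mult.assoc mult.commute mult.right_neutral)
    finally have sum: "(\<Sum>i\<in>I. a i) = v" .
    show ?thesis
    proof (intro exI[of _ a] conjI ballI)
      fix i assume i: "i \<in> I"
      show "0 \<le> a i" unfolding a_def using \<beta>[OF i] \<kappa>[OF i] v True by simp
      show "a i * \<beta> i \<le> b + \<kappa> i * (\<Sum>j\<in>I. a j)"
        unfolding sum using \<beta>[OF i] by (simp add: a_def)
    qed (simp add: sum v(3))
  next
    case False
    have K: "1 \<le> K" using False r T by (smt (verit) mult_nonpos_nonneg mult_less_0_iff)
    \<comment> \<open>With \<open>b = 0\<close> the exponents must sum to at least 1. Those
      proportional to \<open>\<kappa> i / \<beta> i\<close>, normalised to sum 1, are admissible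
      because \<open>1 \<le> K\<close>.\<close>
    define a where "a i = \<kappa> i / (\<beta> i * K)" for i
    have sum: "(\<Sum>i\<in>I. a i) = 1"
      unfolding a_def using K by (simp add: K_def flip: divide_divide_eq_left sum_divide_distrib)
    show ?thesis
    proof (intro exI[of _ a] conjI ballI)
      fix i assume i: "i \<in> I"
      show "0 \<le> a i" unfolding a_def using \<beta>[OF i] \<kappa>[OF i] K by simp
      have "\<kappa> i / K \<le> \<kappa> i" using K \<kappa>[OF i] by (simp add: divide_le_eq mult_le_cancel_left1)
      thus "a i * \<beta> i \<le> b + \<kappa> i * (\<Sum>j\<in>I. a j)"
        unfolding sum using \<beta>[OF i] False by (simp add: a_def b_def)
    qed (use False in \<open>simp add: sum b_def\<close>)
  qed
qed

lemma enn2real_inverse_exponent: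
  assumes "1 \<le> p"
  shows "0 \<le> enn2real (1 / p)" "enn2real (1 / p) \<le> 1" "p \<noteq> 1 \<Longrightarrow> enn2real (1 / p) < 1"
proof -
  show "0 \<le> enn2real (1 / p)" by simp
  show "enn2real (1 / p) \<le> 1" using assms by (cases rule: ennreal_exponent_cases) auto
  show "enn2real (1 / p) < 1" if "p \<noteq> 1"
    using assms
  proof (cases rule: ennreal_exponent_cases)
    case (2 r)
    thus ?thesis using that by (cases "r = 1") auto
  qed simp
qed

text \<open>With \<kappa> = 1/p the left-hand side is a constant times \<open>H\<close> to the power
  \<open>- (s + card J * (1 - \<kappa>))\<close>. This tends to 0 unless s = 0 and p = 1, the very
  case that \<open>norm_order\<close> leaves out.\<close>

lemma wide_bump_small:
  assumes J: "finite J" "J \<noteq> {}" and \<beta>: "\<And>i. i \<in> J \<Longrightarrow> 0 < \<beta> i" and p: "\<And>i. i \<in> J \<Longrightarrow> 1 \<le> p i"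
    and L: "\<And>i. i \<in> J \<Longrightarrow> 0 < L i"
  shows "\<forall>\<^sub>F H in at_top. \<forall>i\<in>J. \<forall>s\<in>norm_order p \<beta> i.
    C * ((1 / H) ^ card J * H powr (-s) * (\<Prod>j\<in>J. H) powr enn2real (1 / p i)) \<le> L i / 2"
proof (intro eventually_ball_finite J ballI)
  fix i assume i: "i \<in> J"
  show "finite (norm_order p \<beta> i)" by (simp add: norm_order_def)
  fix s assume s: "s \<in> norm_order p \<beta> i"
  define \<kappa> where "\<kappa> = enn2real (1 / p i)"
  note \<kappa> = enn2real_inverse_exponent[OF p[OF i], folded \<kappa>_def]
  have card: "1 \<le> real (card J)" using J by (simp add: Suc_le_eq card_gt_0_iff)
  have "0 < s \<or> s = 0 \<and> \<kappa> < 1"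
    using s \<beta>[OF i] \<kappa>(3) by (auto simp: norm_order_def split: if_splits)
  hence pos: "0 < s + real (card J) * (1 - \<kappa>)"
    using \<kappa>(2) card by (auto intro: add_pos_nonneg)
  have "((\<lambda>H. C * H powr (- (s + real (card J) * (1 - \<kappa>)))) \<longlongrightarrow> C * 0) at_top"
    using pos by (intro tendsto_mult tendsto_const tendsto_neg_powr filterlim_ident) auto
  hence "\<forall>\<^sub>F H in at_top. C * H powr (- (s + real (card J) * (1 - \<kappa>))) < L i / 2"
    using L[OF i] by (intro order_tendstoD(2)) auto
  thus "\<forall>\<^sub>F H in at_top. C * ((1 / H) ^ card J * H powr (-s) * (\<Prod>j\<in>J. H) powr enn2real (1 / p i)) \<le> L i / 2"
    using eventually_gt_at_top[of 0]
  proof eventually_elim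
    case (elim H)
    have "(1 / H) ^ card J = H powr (- real (card J))"
      using elim(2) by (simp add: powr_minus powr_realpow power_one_over inverse_eq_divide)
    moreover have "(\<Prod>j\<in>J. H) powr \<kappa> = H powr (real (card J) * \<kappa>)"
      using elim(2) by (simp add: powr_powr flip: powr_realpow)
    ultimately have "(1 / H) ^ card J * H powr (-s) * (\<Prod>j\<in>J. H) powr \<kappa>
        = H powr (- (s + real (card J) * (1 - \<kappa>)))"
      by (simp add: powr_add[symmetric] algebra_simps)
    thus ?case using elim(1) by (simp add: \<kappa>_def)
  qed
qed

section \<open>The lower bound\<close>

text \<open>Both constants precede n; only the height and the bandwidths of the spike depend on
  it.\<close>

lemma perturbed_densities:
  fixes d :: nat and x0 :: "nat \<Rightarrow> real"
    and \<beta> L :: "nat \<Rightarrow> real" and p :: "nat \<Rightarrow> ennreal" and P :: "nat set set"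
  assumes d: "1 \<le> d"
    and \<beta>: "\<And>i. i \<in> {1..d} \<Longrightarrow> 0 < \<beta> i" and p: "\<And>i. i \<in> {1..d} \<Longrightarrow> 1 \<le> p i"
    and P: "partition_on {1..d} P" and L: "\<And>i. i \<in> {1..d} \<Longrightarrow> 0 < L i"
    and nonempty: "indep_class d p \<beta> L P \<noteq> {}"
  shows "\<exists>c>0. \<exists>K\<ge>0. \<forall>n\<ge>1. \<exists>f0\<in>indep_class d p \<beta> L P. \<exists>f1\<in>indep_class d p \<beta> L P.
    (\<forall>x. 0 < f0 x) \<and>
    (\<integral>\<^sup>+x. ennreal ((f1 x)\<^sup>2 / f0 x) \<partial>leb {1..d}) \<le> ennreal (1 + K / real n) \<and>
    2 * (c * rho_rate n \<beta> p P) \<le> f1 x0 - f0 x0"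
proof -
  define S where "S = {1..d}"
  have S: "finite S" "S \<noteq> {}" using d by (auto simp: S_def)
  note \<beta> = \<beta>[folded S_def] and p = p[folded S_def] and P = P[folded S_def] and L = L[folded S_def]
  have finP: "finite P" using P S(1) by (metis finite_elements)
  have "P \<noteq> {}" using P S(2) by (auto simp: partition_on_def)
  have block: "J \<subseteq> S" "finite J" "J \<noteq> {}" if "J \<in> P" for J
  proof -
    show "J \<subseteq> S" using that P by (auto simp: partition_on_def)
    thus "finite J" using S(1) by (rule finite_subset)
    show "J \<noteq> {}" using that P by (auto simp: partition_on_def)
  qed
  define r where "r = rate_idx \<beta> p P"
  obtain I where I: "I \<in> P" "gamma_idx I \<beta> p = r"
  proof -
    have "r = Min ((\<lambda>J. gamma_idx J \<beta> p) ` P)"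
      unfolding r_def rate_idx_def using finP \<open>P \<noteq> {}\<close> by (intro cInf_eq_Min) auto
    hence "r \<in> (\<lambda>J. gamma_idx J \<beta> p) ` P"
      using Min_in[of "(\<lambda>J. gamma_idx J \<beta> p) ` P"] finP \<open>P \<noteq> {}\<close> by auto
    thus thesis using that by auto
  qed
  \<comment> \<open>A marginal of any member has L1 norm 1, and the Nikolskii condition of order 0
    bounds this norm by \<open>L i\<close>.\<close>
  have L1: "1 \<le> L i" if i: "i \<in> S" "p i = 1" for i
  proof -
    obtain g where g: "g \<in> indep_class d p \<beta> L P" using nonempty by blast
    obtain J where J: "J \<in> P" "i \<in> J" using P i(1) by (auto simp: partition_on_def)
    have "partial_deriv i 0 (marginal S J g) = marginal S J g"
      by (simp add: partial_deriv_def fun_eq_iff)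
    hence "Lp_norm 1 (leb J) (marginal S J g) \<le> ennreal (L i)"
      using g J i by (auto simp: indep_class_def nikolskii_def S_def dest!: bspec)
    moreover have "Lp_norm 1 (leb J) (marginal S J g) = 1"
      using g by (intro marginal_norm_eq_1 S(1) block J) (auto simp: indep_class_def S_def)
    ultimately show ?thesis by simp
  qed
  define \<kappa> where "\<kappa> i = enn2real (1 / p i)" for i
  have \<kappa>: "0 \<le> \<kappa> i" for i by (simp add: \<kappa>_def)
  define nik where "nik J C \<longleftrightarrow> (0 < C \<and> (\<forall>A0 A1 h0 h1 a L.
    0 \<le> A0 \<longrightarrow> 0 \<le> A1 \<longrightarrow> (\<forall>j\<in>J. 0 < h0 j \<and> 0 < h1 j) \<longrightarrow>
    (\<forall>i\<in>J. \<forall>s\<in>norm_order p \<beta> i.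
       C * (A0 * h0 i powr (-s) * (\<Prod>j\<in>J. h0 j) powr enn2real (1 / p i)
          + A1 * h1 i powr (-s) * (\<Prod>j\<in>J. h1 j) powr enn2real (1 / p i)) \<le> L i) \<longrightarrow>
    (\<forall>i\<in>J. p i = 1 \<longrightarrow>
       Lp_norm 1 (leb J) (\<lambda>x. A0 * bump J 1 a h0 x + A1 * bump J wave a h1 x) \<le> ennreal (L i)) \<longrightarrow>
    (\<lambda>x. A0 * bump J 1 a h0 x + A1 * bump J wave a h1 x) \<in> nikolskii J p \<beta> L))" for J and C :: real
  have "\<exists>C. nik J C" if J: "J \<in> P" for J
    unfolding nik_def using block[OF J] by (intro bump_sum_nikolskii \<beta> p) auto
  then obtain C where C: "\<And>J. J \<in> P \<Longrightarrow> nik J (C J)" by metis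
  have C_pos: "0 < C J" if "J \<in> P" for J using C[OF that] by (simp add: nik_def)
  \<comment> \<open>The null may use half of each \<open>L i\<close>; the other half is reserved for
    the spike. One width serves all blocks.\<close>
  obtain H where H: "2 \<le> H" and wide: "\<And>J i s. J \<in> P \<Longrightarrow> i \<in> J \<Longrightarrow> s \<in> norm_order p \<beta> i \<Longrightarrow>
      C J * ((1 / H) ^ card J * H powr (-s) * (\<Prod>j\<in>J. H) powr enn2real (1 / p i)) \<le> L i / 2"
  proof -
    have "\<forall>\<^sub>F H in at_top. \<forall>J\<in>P. \<forall>i\<in>J. \<forall>s\<in>norm_order p \<beta> i.
      C J * ((1 / H) ^ card J * H powr (-s) * (\<Prod>j\<in>J. H) powr enn2real (1 / p i)) \<le> L i / 2"
    proof (rule eventually_ball_finite[OF finP ballI])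
      fix J assume J: "J \<in> P"
      show "\<forall>\<^sub>F H in at_top. \<forall>i\<in>J. \<forall>s\<in>norm_order p \<beta> i.
          C J * ((1 / H) ^ card J * H powr (-s) * (\<Prod>j\<in>J. H) powr enn2real (1 / p i)) \<le> L i / 2"
        using block[OF J] by (intro wide_bump_small \<beta> p L) auto
    qed
    from eventually_happens'[OF _ eventually_conj[OF eventually_ge_at_top[of 2] this]]
    show thesis using that by (auto simp: trivial_limit_at_top_linorder)
  qed
  obtain Cw where Cw: "1 \<le> Cw" "\<And>x. \<bar>gauss_poly wave x\<bar> \<le> Cw * envelope x"
    by (rule gauss_poly_bound[of wave]) blast
  \<comment> \<open>The factor by which, in each coordinate of \<open>I\<close>, the spike profile
    may exceed the null density.\<close>
  define D where "D = Cw * sqrt (2 * pi) * H"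
  have D: "0 < D" unfolding D_def using Cw(1) H by simp
  define b where "b = (if 0 < r then r / (2 * r + 1) else 0)"
  obtain a where a: "\<And>i. i \<in> I \<Longrightarrow> 0 \<le> a i"
      "\<And>i. i \<in> I \<Longrightarrow> a i * \<beta> i \<le> b + \<kappa> i * (\<Sum>j\<in>I. a j)" "1 \<le> 2 * b + (\<Sum>j\<in>I. a j)"
  proof -
    have r: "r = (1 - (\<Sum>i\<in>I. \<kappa> i / \<beta> i)) / (\<Sum>i\<in>I. 1 / \<beta> i)"
      using I(2) by (simp add: gamma_idx_def \<kappa>_def)
    have "\<exists>a. (\<forall>i\<in>I. 0 \<le> a i \<and> a i * \<beta> i \<le> b + \<kappa> i * (\<Sum>j\<in>I. a j)) \<and> 1 \<le> 2 * b + (\<Sum>j\<in>I. a j)"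
      unfolding b_def r using block[OF I(1)] by (intro bandwidth_exponents \<beta> \<kappa>) auto
    thus thesis using that by blast
  qed
  \<comment> \<open>The four conditions keep the gap positive, the \<chi>-square budget within 1/n,
    the alternative nonnegative, and the norms of the spike below \<open>L i / 2\<close>.\<close>
  obtain c where c: "0 < c" "c \<le> 1" "c * D ^ card I \<le> 1" "\<And>i. i \<in> I \<Longrightarrow> C I * c \<le> L i / 2"
  proof -
    define X where "X = insert 1 (insert (1 / D ^ card I) ((\<lambda>i. L i / (2 * C I)) ` I))"
    have X: "finite X" "X \<noteq> {}" "\<forall>x\<in>X. 0 < x"
      unfolding X_def using block[OF I(1)] D L C_pos[OF I(1)] by auto
    hence "0 < Min X" by simp
    moreover have "Min X \<le> 1" "Min X \<le> 1 / D ^ card I"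
      by (intro Min_le X(1); simp add: X_def)+
    moreover have "Min X \<le> L i / (2 * C I)" if "i \<in> I" for i
      using that by (intro Min_le X(1)) (auto simp: X_def)
    ultimately show thesis using D C_pos[OF I(1)]
      by (intro that[of "Min X"]) (auto simp: field_simps)
  qed
  define K where "K = (Cw\<^sup>2 * H * sqrt (2 * pi) * envelope_mass) ^ card I"
  have K: "0 \<le> K" unfolding K_def using H envelope_has_integral(2) by simp
  \<comment> \<open>The peak value of the null factor, which is also a lower bound for the spike
    profile at its centre, as \<open>2 \<le> H\<close>.\<close>
  define g where "g = 1 / (H * sqrt (2 * pi))"
  have g: "0 < g" unfolding g_def using H by simp
  show ?thesis
  proof (rule exI[of _ "c * g ^ d / 2"], intro exI[of _ K] conjI allI impI)
    show "0 < c * g ^ d / 2" using c g by simp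
    fix n :: nat assume n: "1 \<le> n"
    have n1: "1 \<le> real n" using n by simp
    \<comment> \<open>The value 1 outside \<open>I\<close> is a placeholder: the spike has amplitude
      0 in the other blocks, but the Nikolskii criterion asks for positive scales there too.\<close>
    define h where "h i = (if i \<in> I then real n powr - a i else 1)" for i
    have h: "0 < h i" "h i \<le> 1" for i
      using n1 a(1)[of i] powr_mono[of "- a i" 0 "real n"] by (auto simp: h_def)
    define V where "V = (\<Prod>j\<in>I. h j)"
    have V: "V = real n powr - (\<Sum>j\<in>I. a j)"
      unfolding V_def h_def using n1 by (simp add: powr_sum sum_negf[symmetric])
    define A where "A = c * real n powr - b"
    have A: "0 < A" unfolding A_def using c(1) n1 by simp
    have b: "0 \<le> b" by (simp add: b_def)
    have A_le: "A \<le> c"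
      unfolding A_def using c(1) n1 b powr_mono[of "- b" 0 "real n"] by (simp add: mult_left_le)
    define w where "w i t = gauss_poly 1 ((t - x0 i) / H) / H" for i t
    define v where "v i t = (if i \<in> I then gauss_poly wave ((t - x0 i) / h i) else w i t)" for i t
    have w_pos: "0 < w i t" for i t
      unfolding w_def using H by (simp add: gauss_poly_1_pos)
    interpret perturbed_product S P I w v
    proof
      have w_eq: "w i = (\<lambda>t. gauss_poly 1 ((t - x0 i) / H) / H)" for i by (simp add: w_def fun_eq_iff)
      have w_int: "integrable lborel (w i)" for i
        unfolding w_eq using integral_rescale(1)[OF gauss_poly_integrable] H by auto
      show "integrable lborel (w i)" for i by (rule w_int)
      show "(\<integral>t. w i t \<partial>lborel) = 1" for i
        unfolding w_eq using integral_rescale(2)[OF gauss_poly_integrable, of H 1] H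
        by (simp add: gauss_poly_1_integral)
      show "(\<integral>t. v i t \<partial>lborel) = 0" if "i \<in> I" for i
        unfolding v_def using that integral_rescale(2)[OF gauss_poly_integrable, of "h i" wave] h(1)
        by (simp add: gauss_poly_wave_integral)
      show "integrable lborel (v i)" for i
        unfolding v_def[abs_def] using w_int[of i] integral_rescale(1)[OF gauss_poly_integrable] h(1)
        by (cases "i \<in> I") auto
      show "v i = w i" if "i \<notin> I" for i using that by (simp add: v_def fun_eq_iff)
    qed (use S P I w_pos in auto)
    have v_le: "\<bar>\<Prod>i\<in>S. v i (x i)\<bar> \<le> D ^ card I * (\<Prod>i\<in>S. w i (x i))" for x
    proof -
      have "\<bar>v i t\<bar> \<le> (if i \<in> I then D else 1) * w i t" for i t
      proof (cases "i \<in> I")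
        case True
        have "\<bar>v i t\<bar> \<le> Cw * envelope ((t - x0 i) / h i)" using Cw(2) True by (simp add: v_def)
        also have "\<dots> \<le> Cw * (sqrt (2 * pi) * gauss_poly 1 ((t - x0 i) / H))"
          using Cw(1) by (intro mult_left_mono envelope_le_wide_gauss H h) auto
        also have "\<dots> = D * w i t" using H by (simp add: D_def w_def)
        finally show ?thesis using True by simp
      next
        case False
        thus ?thesis using w_pos[of i t] by (simp add: v_def)
      qed
      hence "\<bar>\<Prod>i\<in>S. v i (x i)\<bar> \<le> (\<Prod>i\<in>S. (if i \<in> I then D else 1) * w i (x i))"
        unfolding abs_prod by (intro prod_mono) auto
      also have "(\<Prod>i\<in>S. if i \<in> I then D else 1) = D ^ card I"
        using S(1) block(1)[OF I(1)] by (simp add: prod.If_cases Int_absorb1)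
      hence "(\<Prod>i\<in>S. (if i \<in> I then D else 1) * w i (x i)) = D ^ card I * (\<Prod>i\<in>S. w i (x i))"
        by (simp add: prod.distrib)
      finally show ?thesis .
    qed
    \<comment> \<open>Applied with \<open>B = 0\<close> for the null and \<open>B = A\<close> for
      the alternative.\<close>
    have member: "two_prod S B w v \<in> indep_class d p \<beta> L P" if B: "0 \<le> B" "B \<le> A" for B
    proof -
      have nonneg: "0 \<le> two_prod S B w v x" for x
      proof -
        have W: "0 \<le> (\<Prod>i\<in>S. w i (x i))" using w_pos by (intro prod_nonneg) (simp add: less_imp_le)
        have "\<bar>B * (\<Prod>i\<in>S. v i (x i))\<bar> \<le> c * (D ^ card I * (\<Prod>i\<in>S. w i (x i)))"
          unfolding abs_mult using B A_le c(1) by (intro mult_mono v_le) auto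
        also have "\<dots> = (c * D ^ card I) * (\<Prod>i\<in>S. w i (x i))" by simp
        also have "\<dots> \<le> (\<Prod>i\<in>S. w i (x i))" using mult_right_mono[OF c(3) W] by simp
        finally show ?thesis unfolding two_prod_def by linarith
      qed
      have density: "is_density S (two_prod S B w v)" by (rule is_density_two_prod[OF nonneg])
      have "marginal S J (two_prod S B w v) \<in> nikolskii J p \<beta> L" if J: "J \<in> P" for J
      proof -
        define B' where "B' = (if J = I then B else 0)"
        have B': "0 \<le> B'" using B by (simp add: B'_def)
        have off: "v i = w i" if "i \<in> J" "J \<noteq> I" for i
          using that blocks(4)[OF J] v_eq by blast
        have eq: "marginal S J (two_prod S B w v)
            = (\<lambda>x. (1 / H) ^ card J * bump J 1 x0 (\<lambda>_. H) x + B' * bump J wave x0 h x)"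
        proof
          fix x
          have "(\<Prod>i\<in>J. w i (x i)) = (1 / H) ^ card J * bump J 1 x0 (\<lambda>_. H) x"
            unfolding bump_def w_def by (simp add: prod_dividef power_one_over)
          moreover have "(\<Prod>i\<in>J. v i (x i)) = bump J wave x0 h x" if "J = I"
            unfolding bump_def v_def using that by (intro prod.cong) auto
          ultimately show "marginal S J (two_prod S B w v) x
            = (1 / H) ^ card J * bump J 1 x0 (\<lambda>_. H) x + B' * bump J wave x0 h x"
            unfolding marginal_eq[OF J] by (auto simp: two_prod_def B'_def)
        qed
        have narrow: "C J * (B' * h i powr (-s) * (\<Prod>j\<in>J. h j) powr enn2real (1 / p i)) \<le> L i / 2"
          if i: "i \<in> J" and s: "s \<in> norm_order p \<beta> i" for i s
        proof (cases "J = I")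
          case False
          thus ?thesis using L i block(1)[OF J] by (auto simp: B'_def intro: less_imp_le)
        next
          case True
          have iS: "i \<in> S" using i block(1)[OF J] by auto
          \<comment> \<open>Bandwidths are at most 1, so the highest order \<open>\<beta> i\<close>
            gives the most restrictive bound on the spike.\<close>
          have "s \<le> \<beta> i"
            using s \<beta>[OF iS] strict_floor_greatest(1)[OF \<beta>[OF iS]]
            by (auto simp: norm_order_def split: if_splits)
          hence "h i powr (-s) \<le> h i powr (- \<beta> i)" using h by (intro powr_mono') (auto intro: less_imp_le)
          hence "B' * h i powr (-s) * V powr \<kappa> i \<le> A * h i powr (- \<beta> i) * V powr \<kappa> i"
            using B B' by (intro mult_right_mono mult_mono) (auto simp: B'_def)
          \<comment> \<open>The exponent is nonpositive by the smoothness inequality satisfied by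
            \<open>a\<close>.\<close>
          also have "\<dots> = c * real n powr (a i * \<beta> i - (b + \<kappa> i * (\<Sum>j\<in>I. a j)))"
            using i True n1
            by (simp add: A_def V h_def powr_powr powr_add[symmetric] algebra_simps)
          also have "\<dots> \<le> c * real n powr 0"
            using a(2)[of i] i True c(1) n1 by (intro mult_left_mono powr_mono) auto
          finally have "B' * h i powr (-s) * V powr \<kappa> i \<le> c" using n1 by simp
          hence "C I * (B' * h i powr (-s) * V powr \<kappa> i) \<le> C I * c"
            using C_pos[OF I(1)] by (intro mult_left_mono) auto
          also have "\<dots> \<le> L i / 2" using c(4) i True by simp
          finally show ?thesis using True by (simp add: V_def \<kappa>_def)
        qed
        have constraint: "C J * ((1 / H) ^ card J * H powr (-s) * (\<Prod>j\<in>J. H) powr enn2real (1 / p i)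
            + B' * h i powr (-s) * (\<Prod>j\<in>J. h j) powr enn2real (1 / p i)) \<le> L i"
          if "i \<in> J" "s \<in> norm_order p \<beta> i" for i s
          unfolding distrib_left using wide[OF J that] narrow[OF that] by linarith
        have "Lp_norm 1 (leb J) (marginal S J (two_prod S B w v)) = 1"
          by (rule marginal_norm_eq_1[OF S(1) block(1)[OF J] density])
        hence norm1: "Lp_norm 1 (leb J) (\<lambda>x. (1 / H) ^ card J * bump J 1 x0 (\<lambda>_. H) x + B' * bump J wave x0 h x)
            \<le> ennreal (L i)" if "i \<in> J" "p i = 1" for i
          using L1[of i] that block(1)[OF J] unfolding eq by auto
        show ?thesis
          unfolding eq
        proof (rule C[OF J, unfolded nik_def, THEN conjunct2, rule_format])
          show "0 \<le> (1 / H) ^ card J" using H by simp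
          show "0 < H \<and> 0 < h j" for j using H h by simp
        qed (assumption | rule B' constraint norm1)+
      qed
      thus ?thesis
        using density product_formula unfolding indep_class_def S_def by blast
    qed
    have chi: "(\<integral>\<^sup>+x. ennreal ((two_prod S A w v x)\<^sup>2 / two_prod S 0 w v x) \<partial>leb S) \<le> ennreal (1 + K / real n)"
    proof -
      have "(\<integral>\<^sup>+x. ennreal ((two_prod S A w v x)\<^sup>2 / two_prod S 0 w v x) \<partial>leb S)
        \<le> ennreal (1 + A\<^sup>2 * (\<Prod>i\<in>I. Cw\<^sup>2 * H * sqrt (2 * pi) * envelope_mass * h i))"
        using wave_chi_square[OF Cw(2) H h] A by (intro chi_square_bound) (simp_all add: v_def w_def)
      also have "(\<Prod>i\<in>I. Cw\<^sup>2 * H * sqrt (2 * pi) * envelope_mass * h i) = K * V"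
        by (simp add: K_def V_def prod.distrib power_mult_distrib)
      also have "ennreal (1 + A\<^sup>2 * (K * V)) \<le> ennreal (1 + K / real n)"
      proof (intro ennreal_leI add_left_mono)
        \<comment> \<open>Here the budget inequality
          \<open>1 \<le> 2 * b + (\<Sum>j\<in>I. a j)\<close> turns into the bound 1/n.\<close>
        have "A\<^sup>2 * V = c\<^sup>2 * real n powr (- (2 * b + (\<Sum>j\<in>I. a j)))"
          using n1 by (simp add: A_def V power2_eq_square powr_add[symmetric] algebra_simps)
        also have "\<dots> \<le> 1 * real n powr (- 1)"
          using c(1,2) a(3) n1 by (intro mult_mono powr_mono power_le_one) auto
        finally have "A\<^sup>2 * V \<le> 1 / real n" using n1 by (simp add: powr_minus_divide)
        from mult_left_mono[OF this K] show "A\<^sup>2 * (K * V) \<le> K / real n" by (simp add: mult_ac)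
      qed
      finally show ?thesis .
    qed
    have rho: "rho_rate n \<beta> p P = real n powr - b"
    proof -
      have "(1 / real n) powr y = real n powr - y" for y
        using n1 by (simp add: powr_minus powr_divide inverse_eq_divide)
      thus ?thesis
        unfolding rho_rate_def phi_rate_def r_def[symmetric] b_def using n1 by auto
    qed
    have gap: "2 * (c * g ^ d / 2 * rho_rate n \<beta> p P) \<le> two_prod S A w v x0 - two_prod S 0 w v x0"
    proof -
      have "g \<le> v i (x0 i)" for i
        using H by (simp add: v_def w_def g_def gauss_poly_def wave_def normal_density_def field_simps)
      hence "(\<Prod>i\<in>S. g) \<le> (\<Prod>i\<in>S. v i (x0 i))" using g by (intro prod_mono) auto
      hence "A * g ^ d \<le> A * (\<Prod>i\<in>S. v i (x0 i))" using A by (simp add: S_def)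
      thus ?thesis by (simp add: two_prod_def rho A_def mult_ac)
    qed
    show "\<exists>f0\<in>indep_class d p \<beta> L P. \<exists>f1\<in>indep_class d p \<beta> L P. (\<forall>x. 0 < f0 x) \<and>
      (\<integral>\<^sup>+x. ennreal ((f1 x)\<^sup>2 / f0 x) \<partial>leb {1..d}) \<le> ennreal (1 + K / real n) \<and>
      2 * (c * g ^ d / 2 * rho_rate n \<beta> p P) \<le> f1 x0 - f0 x0"
    proof -
      have "two_prod S 0 w v \<in> indep_class d p \<beta> L P" "two_prod S A w v \<in> indep_class d p \<beta> L P"
        using A by (auto intro!: member)
      moreover have "\<forall>x. 0 < two_prod S 0 w v x"
        unfolding two_prod_def using w_pos by (simp add: prod_pos)
      ultimately show ?thesis using chi gap unfolding S_def by blast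
    qed
  qed (rule K)
qed

theorem theorem2:
  fixes d :: nat and q :: real and x0 :: "nat \<Rightarrow> real"
    and \<beta> L :: "nat \<Rightarrow> real" and p :: "nat \<Rightarrow> ennreal" and P :: "nat set set"
  assumes "1 \<le> d" and "1 \<le> q" and "x0 \<in> space (leb {1..d})"
    and "\<And>i. i \<in> {1..d} \<Longrightarrow> 0 < \<beta> i"
    and "\<And>i. i \<in> {1..d} \<Longrightarrow> 1 \<le> p i"
    and "partition_on {1..d} P"
    and "\<And>i. i \<in> {1..d} \<Longrightarrow> 0 < L i"
    and nonempty: "indep_class d p \<beta> L P \<noteq> {}"
  shows "\<exists>c::real. c > 0 \<and>
    liminf (\<lambda>n. ennreal (inverse (rho_rate n \<beta> p P)) *
                (INF T \<in> estimators d n. risk q d n x0 T (indep_class d p \<beta> L P)))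
      \<ge> ennreal c"
proof -
  obtain c K where c: "0 < c" "0 \<le> K" and fam: "\<And>n. 1 \<le> n \<Longrightarrow>
    \<exists>f0\<in>indep_class d p \<beta> L P. \<exists>f1\<in>indep_class d p \<beta> L P. (\<forall>x. 0 < f0 x) \<and>
    (\<integral>\<^sup>+x. ennreal ((f1 x)\<^sup>2 / f0 x) \<partial>leb {1..d}) \<le> ennreal (1 + K / real n) \<and>
    2 * (c * rho_rate n \<beta> p P) \<le> f1 x0 - f0 x0"
  proof -
    note ex = perturbed_densities[OF assms(1,4,5,6,7) nonempty, of x0]
    show thesis using ex that by blast
  qed
  \<comment> \<open>Under one of the two laws the estimation error is at least
    \<open>c * \<rho>\<close> with probability at least \<open>1 / (4 * exp K)\<close>; the power
    1/q comes from Markov's inequality for the q-th moment.\<close>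
  define \<eta> where "\<eta> = (1 / (4 * exp K)) powr (1 / q)"
  have \<eta>: "0 < \<eta>" by (simp add: \<eta>_def)
  have "ennreal (c * \<eta>) \<le> ennreal (inverse (rho_rate n \<beta> p P)) *
      (INF T \<in> estimators d n. risk q d n x0 T (indep_class d p \<beta> L P))" if n: "1 \<le> n" for n
  proof -
    define \<rho> where "\<rho> = rho_rate n \<beta> p P"
    have \<rho>: "0 < \<rho>"
      unfolding \<rho>_def rho_rate_def phi_rate_def using n by (cases "rate_idx \<beta> p P \<le> 0") auto
    obtain f0 f1 where f: "f0 \<in> indep_class d p \<beta> L P" "f1 \<in> indep_class d p \<beta> L P" "\<And>x. 0 < f0 x"
      "(\<integral>\<^sup>+x. ennreal ((f1 x)\<^sup>2 / f0 x) \<partial>leb {1..d}) \<le> ennreal (1 + K / real n)"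
      "2 * (c * \<rho>) \<le> f1 x0 - f0 x0"
      using fam[OF n] unfolding \<rho>_def by blast
    have dens: "is_density {1..d} f0" "is_density {1..d} f1"
      using f(1,2) by (auto simp: indep_class_def)
    have "ennreal (c * \<rho> * \<eta>) \<le> risk q d n x0 T (indep_class d p \<beta> L P)" if T: "T \<in> estimators d n" for T
      unfolding \<eta>_def
    proof (rule two_density_risk[where ?f0.0 = f0 and ?f1.0 = f1])
      show "f0 \<in> borel_measurable (leb {1..d})" "(\<integral>\<^sup>+x. ennreal (f0 x) \<partial>leb {1..d}) = 1"
        using dens(1) by (simp_all add: is_density_def del: One_nat_def)
      show "0 \<le> c * \<rho>" using c \<rho> by simp
    qed (simp_all only: assms dens f c n T)
    hence "ennreal (c * \<rho> * \<eta>) \<le> (INF T \<in> estimators d n. risk q d n x0 T (indep_class d p \<beta> L P))"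
      by (rule INF_greatest)
    hence "ennreal (inverse \<rho>) * ennreal (c * \<rho> * \<eta>)
        \<le> ennreal (inverse \<rho>) * (INF T \<in> estimators d n. risk q d n x0 T (indep_class d p \<beta> L P))"
      by (rule mult_left_mono) simp
    moreover have "ennreal (inverse \<rho>) * ennreal (c * \<rho> * \<eta>) = ennreal (c * \<eta>)"
      using \<rho> c \<eta> by (simp flip: ennreal_mult)
    ultimately show ?thesis by (simp add: \<rho>_def)
  qed
  hence "ennreal (c * \<eta>) \<le> liminf (\<lambda>n. ennreal (inverse (rho_rate n \<beta> p P)) *
      (INF T \<in> estimators d n. risk q d n x0 T (indep_class d p \<beta> L P)))"
    by (intro Liminf_bounded eventually_sequentiallyI[of 1]) auto
  thus ?thesis using c \<eta> by (intro exI[of _ "c * \<eta>"]) simp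
qed

end
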